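(* For each positive integer $n$ there exists a genus zero embedded harmonic surface in $\mathbb{R}^3$ with exactly $2n+1$ ends, namely $2n-1$ ends of type $(0,2,2)$ (planar ends) stacked between two ends of type $(1,2,2)$ (catenoid ends), such that each of the $2n+1$ ends has vertical limiting normal.
   Context: Harmonic surface: let $X$ be a compact Riemann surface, $p_1,\dots,p_m\in X$, $X'=X\setminus\{p_1,\dots,p_m\}$, and let $\omega_1,\omega_2,\omega_3$ be meromorphic one-forms on $X$ that are holomorphic on $X'$. If $\operatorname{Re}\int_\gamma(\omega_1,\omega_2,\omega_3)=(0,0,0)$ for every closed curve $\gamma$ in $X'$, then $f(z)=\operatorname{Re}\int^z(\omega_1,\omega_2,\omega_3)$ is a well-defined harmonic map $X'\to\mathbb{R}^3$ with ends at $p_1,\dots,p_m$; its image $f(X')$ is called a harmonic surface, with Weierstrass representation (Weierstrass data) $(X',(\omega_1,\omega_2,\omega_3))$. Its genus is the genus of $X$. It is embedded if $f$ is an injective immersion. Type of an end: let $n_i^j$ be the order of the pole of $\omega_i$ at $p_j$ ($0$ if $\omega_i$ is holomorphic there). Two ends are affinely equivalent if they differ by an (invertible) real affine transformation of $\mathbb{R}^3$, whose linear part acts on $(\omega_1,\omega_2,\omega_3)$. An end is in reduced form if $n_1^j\le n_2^j\le n_3^j$ and $(n_1^j,n_2^j,n_3^j)$ is minimal in lexicographic ordering among all affinely equivalent ends. The type of an end is the tuple of pole orders of an affinely equivalent end in reduced form. Limiting normal: the Gauss map $N:X'\to S^2$ is the normalization of the vector $\operatorname{Im}(\omega_2\overline{\omega_3},\omega_3\overline{\omega_1},\omega_1\overline{\omega_2})$.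 The end at $p_j$ has vertical limiting normal if $N$ extends continuously to $p_j$ with $N(p_j)=(0,0,\pm1)$. Stacked: the third coordinate of $f$ tends to $-\infty$ at one catenoid end and to $+\infty$ at the other, and the planar ends lie between them at finite, pairwise distinct heights (limits of the third coordinate). *)

theory Defs
  imports "HOL-Complex_Analysis.Complex_Analysis" "HOL-Homology.Homology"
begin

section \<open>Compact Riemann surfaces\<close>

type_synonym 'a chart = "'a set \<times> ('a \<Rightarrow> complex)"

abbreviation cdom :: "'a chart \<Rightarrow> 'a set" where "cdom c \<equiv> fst c"
abbreviation cmap :: "'a chart \<Rightarrow> 'a \<Rightarrow> complex" where "cmap c \<equiv> snd c"
abbreviation cinv :: "'a chart \<Rightarrow> complex \<Rightarrow> 'a" where "cinv c \<equiv> inv_into (fst c) (snd c)"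

text \<open>The atlas need not be maximal: any holomorphic atlas determines the complex structure.\<close>

definition compact_riemann_surface :: "'a topology \<Rightarrow> 'a chart set \<Rightarrow> bool" where
  "compact_riemann_surface X \<A> \<longleftrightarrow>
     topspace X \<noteq> {} \<and> compact_space X \<and> connected_space X \<and> Hausdorff_space X \<and>
     (\<Union>c\<in>\<A>. cdom c) = topspace X \<and>
     (\<forall>c\<in>\<A>. openin X (cdom c) \<and> open (cmap c ` cdom c) \<and>
        homeomorphic_map (subtopology X (cdom c)) (top_of_set (cmap c ` cdom c)) (cmap c)) \<and>
     (\<forall>c\<in>\<A>. \<forall>d\<in>\<A>. (cmap d \<circ> cinv c) holomorphic_on cmap c ` (cdom c \<inter> cdom d))"

text \<open>A compact Riemann surface has genus \<open>g\<close> iff its first integral homology group is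
  free abelian of rank \<open>2 * g\<close>.\<close>

definition has_genus :: "'a topology \<Rightarrow> nat \<Rightarrow> bool" where
  "has_genus X g \<longleftrightarrow> homology_group 1 X \<cong> free_Abelian_group {..<2 * g}"

text \<open>The objects below do not depend on which chart around \<open>p\<close> is picked.\<close>

definition chart_at :: "'a chart set \<Rightarrow> 'a \<Rightarrow> 'a chart" where
  "chart_at \<A> p = (SOME c. c \<in> \<A> \<and> p \<in> cdom c)"

section \<open>Meromorphic one-forms\<close>

text \<open>A one-form \<open>w\<close> is given by its coefficients: on \<open>cdom c\<close> it is \<open>w c p dz\<close>, where
  \<open>z\<close> is the local coordinate \<open>cmap c\<close>. Values at points of the pole set \<open>P\<close> are irrelevant.\<close>

type_synonym 'a one_form = "'a chart \<Rightarrow> 'a \<Rightarrow> complex"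

definition coeff_fun :: "'a one_form \<Rightarrow> 'a chart \<Rightarrow> complex \<Rightarrow> complex" where
  "coeff_fun w c = (\<lambda>z. w c (cinv c z))"

definition meromorphic_one_form ::
    "'a topology \<Rightarrow> 'a chart set \<Rightarrow> 'a set \<Rightarrow> 'a one_form \<Rightarrow> bool" where
  "meromorphic_one_form X \<A> P w \<longleftrightarrow>
     (\<forall>c\<in>\<A>. coeff_fun w c meromorphic_on cmap c ` cdom c \<and>
             coeff_fun w c holomorphic_on cmap c ` (cdom c - P)) \<and>
     (\<forall>c\<in>\<A>. \<forall>d\<in>\<A>. \<forall>p\<in>cdom c \<inter> cdom d - P.
        w c p = w d p * deriv (cmap d \<circ> cinv c) (cmap c p))"

definition pole_order :: "'a chart set \<Rightarrow> 'a one_form \<Rightarrow> 'a \<Rightarrow> nat" where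
  "pole_order \<A> w p =
     (let c = chart_at \<A> p; g = coeff_fun w c; z = cmap c p
      in if is_pole g z then nat (- zorder g z) else 0)"

section \<open>Integration of one-forms along curves\<close>

text \<open>Piecewise continuously differentiable curves in the open subset \<open>S\<close> of \<open>X\<close>; compare
  \<^const>\<open>piecewise_C1_differentiable_on\<close>.\<close>

definition curve_in :: "'a topology \<Rightarrow> 'a chart set \<Rightarrow> 'a set \<Rightarrow> (real \<Rightarrow> 'a) \<Rightarrow> bool" where
  "curve_in X \<A> S \<gamma> \<longleftrightarrow>
     pathin (subtopology X S) \<gamma> \<and>
     (\<exists>T. finite T \<and>
        (\<forall>c\<in>\<A>. (cmap c \<circ> \<gamma>) C1_differentiable_on {t \<in> {0..1} - T. \<gamma> t \<in> cdom c}))"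

text \<open>The integrand at \<open>t\<close> is \<open>w\<close> evaluated on the velocity of \<open>\<gamma>\<close> at \<open>t\<close>.\<close>

definition form_integral :: "'a chart set \<Rightarrow> 'a one_form \<Rightarrow> (real \<Rightarrow> 'a) \<Rightarrow> complex" where
  "form_integral \<A> w \<gamma> =
     integral {0..1}
       (\<lambda>t. let c = chart_at \<A> (\<gamma> t)
            in w c (\<gamma> t) * vector_derivative (cmap c \<circ> \<gamma>) (at t))"

section \<open>Harmonic surfaces\<close>

definition harmonic_surface ::
    "'a topology \<Rightarrow> 'a chart set \<Rightarrow> 'a set \<Rightarrow> 'a one_form ^ 3 \<Rightarrow> bool" where
  "harmonic_surface X \<A> P \<omega> \<longleftrightarrow>
     compact_riemann_surface X \<A> \<and> finite P \<and> P \<subseteq> topspace X \<and>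
     (\<forall>i. meromorphic_one_form X \<A> P (\<omega> $ i)) \<and>
     (\<forall>\<gamma>. curve_in X \<A> (topspace X - P) \<gamma> \<and> \<gamma> 0 = \<gamma> 1 \<longrightarrow>
        (\<forall>i. Re (form_integral \<A> (\<omega> $ i) \<gamma>) = 0))"

text \<open>The map \<open>z \<mapsto> Re \<integral> \<omega>\<close> with base point \<open>z0\<close>; by the period condition the choice of the
  curve does not matter.\<close>

definition harmonic_map ::
    "'a topology \<Rightarrow> 'a chart set \<Rightarrow> 'a set \<Rightarrow> 'a one_form ^ 3 \<Rightarrow> 'a \<Rightarrow> 'a \<Rightarrow> real ^ 3" where
  "harmonic_map X \<A> P \<omega> z0 z =
     (let \<gamma> = (SOME \<gamma>. curve_in X \<A> (topspace X - P) \<gamma> \<and> \<gamma> 0 = z0 \<and> \<gamma> 1 = z)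
      in \<chi> i. Re (form_integral \<A> (\<omega> $ i) \<gamma>))"

definition immersion_on :: "'a chart set \<Rightarrow> 'a set \<Rightarrow> ('a \<Rightarrow> real ^ 3) \<Rightarrow> bool" where
  "immersion_on \<A> S f \<longleftrightarrow>
     (\<forall>c\<in>\<A>. \<forall>p\<in>cdom c \<inter> S.
        \<exists>D. ((f \<circ> cinv c) has_derivative D) (at (cmap c p)) \<and> inj D)"

definition embedded_on :: "'a chart set \<Rightarrow> 'a set \<Rightarrow> ('a \<Rightarrow> real ^ 3) \<Rightarrow> bool" where
  "embedded_on \<A> S f \<longleftrightarrow> inj_on f S \<and> immersion_on \<A> S f"

section \<open>Types of ends\<close>

definition pole_orders ::
    "'a chart set \<Rightarrow> 'a one_form ^ 3 \<Rightarrow> 'a \<Rightarrow> nat \<times> nat \<times> nat" where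
  "pole_orders \<A> \<omega> p =
     (pole_order \<A> (\<omega> $ 1) p, pole_order \<A> (\<omega> $ 2) p, pole_order \<A> (\<omega> $ 3) p)"

text \<open>The action of the linear part of an affine map; translations do not change the forms.\<close>

definition linear_act :: "real ^ 3 ^ 3 \<Rightarrow> 'a one_form ^ 3 \<Rightarrow> 'a one_form ^ 3" where
  "linear_act M \<omega> = (\<chi> i. (\<lambda>c p. \<Sum>j\<in>UNIV. complex_of_real (M $ i $ j) * (\<omega> $ j) c p))"

definition lex3 :: "((nat \<times> nat \<times> nat) \<times> (nat \<times> nat \<times> nat)) set" where
  "lex3 = less_than <*lex*> less_than <*lex*> less_than"

definition reduced_end :: "'a chart set \<Rightarrow> 'a one_form ^ 3 \<Rightarrow> 'a \<Rightarrow> bool" where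
  "reduced_end \<A> \<omega> p \<longleftrightarrow>
     pole_order \<A> (\<omega> $ 1) p \<le> pole_order \<A> (\<omega> $ 2) p \<and>
     pole_order \<A> (\<omega> $ 2) p \<le> pole_order \<A> (\<omega> $ 3) p \<and>
     (\<forall>M. invertible M \<longrightarrow>
        (pole_orders \<A> (linear_act M \<omega>) p, pole_orders \<A> \<omega> p) \<notin> lex3)"

definition end_has_type ::
    "'a chart set \<Rightarrow> 'a one_form ^ 3 \<Rightarrow> 'a \<Rightarrow> nat \<times> nat \<times> nat \<Rightarrow> bool" where
  "end_has_type \<A> \<omega> p \<tau> \<longleftrightarrow>
     (\<exists>M. invertible M \<and> reduced_end \<A> (linear_act M \<omega>) p \<and>
          pole_orders \<A> (linear_act M \<omega>) p = \<tau>)"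

abbreviation planar_end :: "'a chart set \<Rightarrow> 'a one_form ^ 3 \<Rightarrow> 'a \<Rightarrow> bool" where
  "planar_end \<A> \<omega> p \<equiv> end_has_type \<A> \<omega> p (0, 2, 2)"

abbreviation catenoid_end :: "'a chart set \<Rightarrow> 'a one_form ^ 3 \<Rightarrow> 'a \<Rightarrow> bool" where
  "catenoid_end \<A> \<omega> p \<equiv> end_has_type \<A> \<omega> p (1, 2, 2)"

section \<open>Limiting normals and stacked ends\<close>

text \<open>Changing the chart multiplies the vector below by a positive factor;
  \<^const>\<open>sgn\<close> normalizes it.\<close>

definition gauss_map :: "'a chart set \<Rightarrow> 'a one_form ^ 3 \<Rightarrow> 'a \<Rightarrow> real ^ 3" where
  "gauss_map \<A> \<omega> p =
     (let c = chart_at \<A> p; w1 = (\<omega> $ 1) c p; w2 = (\<omega> $ 2) c p; w3 = (\<omega> $ 3) c p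
      in sgn (vector [Im (w2 * cnj w3), Im (w3 * cnj w1), Im (w1 * cnj w2)]))"

definition vertical_limiting_normal ::
    "'a topology \<Rightarrow> 'a chart set \<Rightarrow> 'a one_form ^ 3 \<Rightarrow> 'a \<Rightarrow> bool" where
  "vertical_limiting_normal X \<A> \<omega> p \<longleftrightarrow>
     (gauss_map \<A> \<omega> \<longlongrightarrow> vector [0, 0, 1]) (atin X p) \<or>
     (gauss_map \<A> \<omega> \<longlongrightarrow> vector [0, 0, - 1]) (atin X p)"

text \<open>The ends in \<open>Q\<close> lie at finite, pairwise distinct heights, between the bottom end \<open>a\<close> and
  the top end \<open>b\<close>.\<close>

definition stacked ::
    "'a topology \<Rightarrow> ('a \<Rightarrow> real ^ 3) \<Rightarrow> 'a \<Rightarrow> 'a set \<Rightarrow> 'a \<Rightarrow> bool" where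
  "stacked X f a Q b \<longleftrightarrow>
     filterlim (\<lambda>z. f z $ 3) at_bot (atin X a) \<and>
     filterlim (\<lambda>z. f z $ 3) at_top (atin X b) \<and>
     (\<exists>h. inj_on h Q \<and> (\<forall>p\<in>Q. ((\<lambda>z. f z $ 3) \<longlongrightarrow> h p) (atin X p)))"

end

theory Submission
  imports Defs
begin

text \<open>On the sphere with coordinate \<open>z\<close> take the third form to be \<open>dz / z\<close>, so the height is
  \<open>ln \<bar>z\<bar>\<close> and the horizontal slices are the images of the circles \<open>\<bar>z\<bar> = r\<close>. With
  \<open>m = 2 n\<close> and \<open>p\<^sub>j = 1000 ^ j\<close> let the horizontal projection, as a map to the complex plane, be the sum
  of \<open>p\<^sub>j / (z - p\<^sub>j)\<close> over odd \<open>j < m\<close> minus the conjugate of the sum of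
  \<open>p\<^sub>j / (z - p\<^sub>j)\<close> over even \<open>0 < j < m\<close>, of \<open>1 / z\<close> and of \<open>- z / p\<^sub>m\<close>. Between two
  consecutive ends a slice has a fixed orientation, and passing a planar end reverses it; alternating between
  holomorphic and antiholomorphic terms makes neighbouring terms agree about the orientation, and the signs
  make them reinforce each other. A single term maps every circle to a circle or a line. Because the \<open>p\<^sub>j\<close> are
  far apart, on each circle either one term dominates all chords or two neighbouring terms of nearly the
  same argument do. So no chord, and no tangent vector, of a slice vanishes.\<close>

section \<open>Chords of the level curves\<close>

text \<open>A harmonic surface obeys no conformality condition, so its horizontal projection may be
  any sum \<open>h + cnj k\<close> with \<open>h\<close> and \<open>k\<close> holomorphic. For
  rational \<open>h\<close> and \<open>k\<close> only the height form \<open>dz / z\<close> has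
  residues, and they are real, so all real periods vanish. Injectivity and immersion come from one
  estimate. The difference quotient of each term between two points \<open>z\<close> and
  \<open>w\<close> of a circle is an explicit product that still makes sense at
  \<open>w = z\<close>, where it describes the tangent. The obstacle is a radius near the geometric
  mean of two neighbouring poles: there two terms have comparable size and could cancel. No spacing
  of the poles removes such radii; only the agreement of the two arguments helps. The ratio 1000
  fits the factor 10 that serves as the meaning of "far": a circle within a factor 10 of one
  \<open>pole j\<close> is a factor 100 or more away from every other one, and a pole at distance
  factor 10 or more distorts the limiting form of its term by a relative error of at most
  7/27.\<close>

text \<open>Indices \<open>0\<close> and \<open>m\<close> stand for the catenoid ends at \<open>0\<close> and infinity.\<close>

definition pole :: "nat \<Rightarrow> real" where
  "pole j = 1000 ^ j"

text \<open>The terms at \<open>0\<close> and \<open>m\<close> are truncations of the general one.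
  For \<open>p\<close> far inside the circle \<open>p / (z - p)\<close> is close to
  \<open>p / z\<close>, which is \<open>1 / z\<close> for \<open>pole 0 = 1\<close>. For
  \<open>p\<close> far outside it is close to \<open>- 1 - z / p\<close>, which is
  \<open>- z / pole m\<close> up to a constant.\<close>

definition pot :: "nat \<Rightarrow> nat \<Rightarrow> complex \<Rightarrow> complex" where
  "pot m j z = (if j = 0 then 1 / z else if j = m then - z / of_real (pole m)
                else of_real (pole j) / (z - of_real (pole j)))"

definition quot :: "nat \<Rightarrow> nat \<Rightarrow> complex \<Rightarrow> complex \<Rightarrow> complex" where
  "quot m j z w = (if j = 0 then 1 / (z * w) else if j = m then 1 / of_real (pole m)
                   else of_real (pole j) / ((z - of_real (pole j)) * (w - of_real (pole j))))"

text \<open>The finite ends are \<open>0\<close> and \<open>pole j\<close> for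
  \<open>0 < j < m\<close>. The numbers \<open>pole 0\<close> and \<open>pole m\<close> merely scale
  the two catenoid terms and are themselves regular points.\<close>

definition regular :: "nat \<Rightarrow> complex set" where
  "regular m = - insert 0 ((\<lambda>j. of_real (pole j)) ` {1..<m})"

lemma regularD:
  assumes "z \<in> regular m"
  shows "z \<noteq> 0" "1 \<le> j \<Longrightarrow> j < m \<Longrightarrow> z \<noteq> of_real (pole j)"
  using assms by (auto simp: regular_def)

lemma pole_pos [simp]: "pole j > 0" "pole j \<ge> 0" "pole j \<noteq> 0"
  by (simp_all add: pole_def)

lemma pot_diff:
  assumes "z \<in> regular m" "w \<in> regular m" "j \<le> m"
  shows "pot m j z - pot m j w = (w - z) * quot m j z w"
proof -
  consider "j = 0" | "j \<noteq> 0" "j = m" | "1 \<le> j" "j < m" using assms(3) by linarith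
  then show ?thesis
  proof cases
    case 1
    then show ?thesis using regularD[OF assms(1)] regularD[OF assms(2)]
      by (simp add: pot_def quot_def divide_simps)
  next
    case 2
    then show ?thesis by (simp add: pot_def quot_def diff_divide_distrib)
  next
    case 3
    then have "z - of_real (pole j) \<noteq> 0" "w - of_real (pole j) \<noteq> 0"
      using regularD(2)[OF assms(1)] regularD(2)[OF assms(2)] by auto
    then have "of_real (pole j) / (z - of_real (pole j)) - of_real (pole j) / (w - of_real (pole j))
        = (w - z) * (of_real (pole j) / ((z - of_real (pole j)) * (w - of_real (pole j))))"
      by (simp add: divide_simps) (simp add: algebra_simps)
    with 3 show ?thesis by (simp add: pot_def quot_def)
  qed
qed

section \<open>Size of a single term on a circle\<close>

lemma norm_inverse_prod_minus_1_le:
  fixes x y :: complex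
  assumes "norm x \<le> 1 / 10" "norm y \<le> 1 / 10"
  shows "norm (1 / ((1 - x) * (1 - y)) - 1) \<le> 7 / 27"
proof -
  have lo: "norm (1 - x) \<ge> 9 / 10" "norm (1 - y) \<ge> 9 / 10"
    using norm_triangle_ineq2[of 1 x] norm_triangle_ineq2[of 1 y] assms by auto
  then have nz: "1 - x \<noteq> 0" "1 - y \<noteq> 0" by auto
  have eq: "1 / ((1 - x) * (1 - y)) - 1 = (x + y - x * y) / ((1 - x) * (1 - y))"
    using nz by (simp add: divide_simps) (simp add: algebra_simps)
  have "norm (x + y - x * y) \<le> norm x + norm y + norm x * norm y"
    by (metis (no_types, lifting) add_right_mono norm_mult norm_triangle_ineq norm_triangle_ineq4 order_trans)
  also have "\<dots> \<le> 1 / 10 + 1 / 10 + 1 / 10 * (1 / 10)"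
    using assms by (intro add_mono mult_mono) auto
  finally have num: "norm (x + y - x * y) \<le> 21 / 100" by simp
  have "norm (1 - x) * norm (1 - y) \<ge> 9 / 10 * (9 / 10)"
    using lo by (intro mult_mono) auto
  then have den: "norm ((1 - x) * (1 - y)) \<ge> 81 / 100" by (simp add: norm_mult)
  \<comment> \<open>The constant of the claim is \<open>21 / 81\<close>.\<close>
  have "norm ((x + y - x * y) / ((1 - x) * (1 - y))) \<le> (21 / 100) / (81 / 100)"
    unfolding norm_divide using num den by (intro frac_le) auto
  then show ?thesis unfolding eq by simp
qed

text \<open>With \<open>p = pole j\<close> far inside the circle, dividing \<open>z - p\<close> by
  \<open>z\<close> and \<open>w - p\<close> by \<open>w\<close> shows that the quotient is
  \<open>p / (z * w)\<close> up to the relative error of the preceding estimate. For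
  \<open>j = 0\<close> there is no error.\<close>

lemma quot_inner:
  assumes "z \<in> regular m" "w \<in> regular m" "norm z = r" "norm w = r"
    and "j < m" "10 * pole j \<le> r"
  shows "norm (z * w * quot m j z w - of_real (pole j)) \<le> 7 / 27 * pole j"
proof (cases "j = 0")
  case True
  then show ?thesis using regularD(1)[OF assms(1)] regularD(1)[OF assms(2)]
    by (simp add: quot_def pole_def)
next
  case False
  define p where "p = pole j"
  have p: "p > 0" by (simp add: p_def)
  have nz: "z \<noteq> 0" "w \<noteq> 0" "z - of_real p \<noteq> 0" "w - of_real p \<noteq> 0"
    using regularD[OF assms(1)] regularD[OF assms(2)] False assms(5) unfolding p_def
    by (auto simp: Suc_le_eq)
  have r: "r > 0" using nz assms(3) by auto
  have le: "norm (of_real p / z) \<le> 1 / 10" "norm (of_real p / w) \<le> 1 / 10"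
    using assms r p unfolding p_def[symmetric] by (simp_all add: norm_divide divide_simps)
  have "z * w * quot m j z w - of_real p
      = of_real p * (1 / ((1 - of_real p / z) * (1 - of_real p / w)) - 1)"
    using nz False assms(5) unfolding quot_def p_def[symmetric]
    by (simp add: divide_simps) (simp add: algebra_simps)
  then have "norm (z * w * quot m j z w - of_real p)
      = p * norm (1 / ((1 - of_real p / z) * (1 - of_real p / w)) - 1)"
    using p by (simp add: norm_mult)
  also have "\<dots> \<le> p * (7 / 27)"
    using p norm_inverse_prod_minus_1_le[OF le] by (intro mult_left_mono) auto
  finally show ?thesis unfolding p_def by simp
qed

text \<open>The opposite regime: for \<open>p\<close> far outside the circle the term is nearly
  affine, so its quotient is nearly the constant \<open>1 / p\<close>. For \<open>j = m\<close> this
  is exact.\<close>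

lemma quot_outer:
  assumes "z \<in> regular m" "w \<in> regular m" "norm z = r" "norm w = r"
    and "0 < j" "j \<le> m" "10 * r \<le> pole j"
  shows "norm (quot m j z w - of_real (1 / pole j)) \<le> 7 / 27 / pole j"
proof (cases "j = m")
  case True
  then show ?thesis using assms(5) by (simp add: quot_def)
next
  case False
  define p where "p = pole j"
  have p: "p > 0" by (simp add: p_def)
  have nz: "z - of_real p \<noteq> 0" "w - of_real p \<noteq> 0"
    using regularD[OF assms(1)] regularD[OF assms(2)] False assms(5,6) unfolding p_def
    by (auto simp: Suc_le_eq)
  have le: "norm (z / of_real p) \<le> 1 / 10" "norm (w / of_real p) \<le> 1 / 10"
    using assms p unfolding p_def[symmetric] by (simp_all add: norm_divide divide_simps)
  have "quot m j z w - of_real (1 / p)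
      = of_real (1 / p) * (1 / ((1 - z / of_real p) * (1 - w / of_real p)) - 1)"
    using nz p False assms(5) unfolding quot_def p_def[symmetric]
    by (simp add: divide_simps) (simp add: algebra_simps)
  then have "norm (quot m j z w - of_real (1 / p))
      = 1 / p * norm (1 / ((1 - z / of_real p) * (1 - w / of_real p)) - 1)"
    using p by (simp add: norm_mult norm_divide)
  also have "\<dots> \<le> 1 / p * (7 / 27)"
    using p norm_inverse_prod_minus_1_le[OF le] by (intro mult_left_mono) auto
  finally show ?thesis unfolding p_def by simp
qed

lemma norm_quot_inner:
  assumes "z \<in> regular m" "w \<in> regular m" "norm z = r" "norm w = r"
    and "j < m" "10 * pole j \<le> r"
  shows "r\<^sup>2 * norm (quot m j z w) \<le> 34 / 27 * pole j"
proof -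
  have "r\<^sup>2 * norm (quot m j z w) = norm (z * w * quot m j z w)"
    using assms(3,4) by (simp add: norm_mult power2_eq_square)
  also have "\<dots> \<le> norm (z * w * quot m j z w - of_real (pole j)) + norm (of_real (pole j) :: complex)"
    by (metis add.commute diff_add_cancel norm_triangle_ineq)
  also have "\<dots> \<le> 7 / 27 * pole j + pole j"
    using quot_inner[OF assms] by simp
  finally show ?thesis by simp
qed

lemma norm_quot_outer:
  assumes "z \<in> regular m" "w \<in> regular m" "norm z = r" "norm w = r"
    and "0 < j" "j \<le> m" "10 * r \<le> pole j"
  shows "norm (quot m j z w) \<le> 34 / 27 / pole j"
proof -
  have "norm (quot m j z w) \<le> norm (quot m j z w - of_real (1 / pole j)) + norm (of_real (1 / pole j) :: complex)"
    by (metis add.commute diff_add_cancel norm_triangle_ineq)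
  also have "\<dots> \<le> 7 / 27 / pole j + 1 / pole j"
    using quot_outer[OF assms] by (simp add: norm_divide)
  finally show ?thesis by (simp add: field_simps)
qed

text \<open>Since \<open>norm (z - p)\<close> is at most \<open>r + p\<close>, this holds on every
  circle, however close it comes to the pole: closeness only enlarges the quotient.\<close>

lemma norm_quot_ge:
  assumes "z \<in> regular m" "w \<in> regular m" "norm z = r" "norm w = r" "j \<le> m"
  shows "norm (quot m j z w) \<ge> pole j / (r + pole j)\<^sup>2"
proof -
  have r: "r > 0" using regularD(1)[OF assms(1)] assms(3) by auto
  consider "j = 0" | "j \<noteq> 0" "j = m" | "1 \<le> j" "j < m" using assms(5) by linarith
  then show ?thesis
  proof cases
    case 1
    have "1 / (r + 1)\<^sup>2 \<le> 1 / r\<^sup>2"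
      using r by (intro divide_left_mono power_mono) auto
    with 1 show ?thesis using assms(3,4)
      by (simp add: quot_def pole_def norm_divide norm_mult power2_eq_square)
  next
    case 2
    have "pole j / (r + pole j)\<^sup>2 \<le> pole j / (pole j)\<^sup>2"
      using r by (intro divide_left_mono power_mono mult_pos_pos zero_less_power)
        (auto intro: add_pos_pos)
    also have "\<dots> = 1 / pole j" by (simp add: power2_eq_square)
    finally show ?thesis using 2 by (simp add: quot_def norm_divide)
  next
    case 3
    then have nz: "z - of_real (pole j) \<noteq> 0" "w - of_real (pole j) \<noteq> 0"
      using regularD(2)[OF assms(1)] regularD(2)[OF assms(2)] by auto
    have "norm (z - of_real (pole j)) \<le> r + pole j" "norm (w - of_real (pole j)) \<le> r + pole j"
      using norm_triangle_ineq4[of z "of_real (pole j)"] norm_triangle_ineq4[of w "of_real (pole j)"]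
        assms(3,4) by auto
    then have "norm ((z - of_real (pole j)) * (w - of_real (pole j))) \<le> (r + pole j)\<^sup>2"
      unfolding norm_mult power2_eq_square using r by (intro mult_mono) (auto intro: add_nonneg_nonneg)
    then have "pole j / (r + pole j)\<^sup>2
        \<le> pole j / norm ((z - of_real (pole j)) * (w - of_real (pole j)))"
      using nz by (intro divide_left_mono) (auto intro!: mult_pos_pos simp: r add_pos_pos)
    with 3 show ?thesis by (simp add: quot_def norm_divide)
  qed
qed

section \<open>Geometric sums over the poles\<close>

lemma sum_pole_less: "999 * (\<Sum>j<J. pole j) \<le> pole J"
  by (induction J) (simp_all add: pole_def)

lemma sum_inverse_pole_le: "999 * (\<Sum>j\<in>{J<..m}. 1 / pole j) \<le> 1 / pole J"
proof (cases "J \<le> m")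
  case True
  \<comment> \<open>The extra summand \<open>1 / pole m\<close> makes the induction close; with it
    the two sides are in fact equal.\<close>
  have "999 * (\<Sum>j\<in>{J<..m}. 1 / pole j) + 1 / pole m \<le> 1 / pole J"
    using True
  proof (induction m rule: dec_induct)
    case (step k)
    have "{J<..Suc k} = insert (Suc k) {J<..k}" using step by auto
    then show ?case using step by (simp add: pole_def field_simps)
  qed simp
  then show ?thesis using pole_pos[of m] by (smt (verit) divide_pos_pos)
qed simp

lemma pole_mono: "i \<le> j \<Longrightarrow> pole i \<le> pole j"
  by (simp add: pole_def)

lemma pole_less: "i < j \<Longrightarrow> 1000 * pole i \<le> pole j"
  using pole_mono[of "Suc i" j] by (simp add: pole_def)

lemma sum_split_at:
  fixes f :: "nat \<Rightarrow> 'a::comm_monoid_add"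
  assumes "J \<le> m"
  shows "(\<Sum>j\<le>m. f j) = (\<Sum>j<J. f j) + f J + (\<Sum>j\<in>{J<..m}. f j)"
proof -
  have "{..m} = insert J {..<J} \<union> {J<..m}" using assms by auto
  then have "(\<Sum>j\<le>m. f j) = sum f (insert J {..<J}) + (\<Sum>j\<in>{J<..m}. f j)"
    by (simp only:) (rule sum.union_disjoint, auto)
  then show ?thesis by (simp add: add.commute)
qed

text \<open>\<open>chord m j z w\<close> is, up to the common factor \<open>(w - z) / (z * w)\<close>, the contribution of the
  \<open>j\<close>-th end to the chord of the level curve \<open>\<bar>z\<bar> = r\<close>: conjugation is undone by
  \<open>cnj z = r\<^sup>2 / z\<close>.\<close>

definition chord :: "nat \<Rightarrow> nat \<Rightarrow> complex \<Rightarrow> complex \<Rightarrow> complex" where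
  "chord m j z w = (if odd j then z * w * quot m j z w
                    else of_real (norm z * norm w) * cnj (quot m j z w))"

lemma norm_chord:
  "norm (chord m j z w) = norm z * norm w * norm (quot m j z w)"
  by (simp add: chord_def norm_mult)

text \<open>Term \<open>J\<close> outweighs all inner and all outer ends together. If there are
  inner ends, \<open>r + pole J \<le> 11 * r\<close>, so its chord is at least
  \<open>pole J / 121\<close>, while the inner ends reach at most
  \<open>34 / 27 / 999 * pole J\<close>, less than half of that. If there are outer ends,
  \<open>r + pole J \<le> 11 * pole J\<close> gives the same comparison with
  \<open>1 / pole J\<close> in place of \<open>pole J\<close>.\<close>

lemma sum_chord_nonzero_dominant:
  assumes "z \<in> regular m" "w \<in> regular m" "norm z = r" "norm w = r" "J \<le> m"
    and lo: "J = 0 \<or> pole J \<le> 10 * r" and hi: "J = m \<or> r \<le> 10 * pole J"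
  shows "(\<Sum>j\<le>m. chord m j z w) \<noteq> 0"
proof -
  have r: "r > 0" using regularD(1)[OF assms(1)] assms(3) by auto
  let ?N = "\<lambda>j. norm (quot m j z w)"
  have pos: "?N J > 0"
    using norm_quot_ge[OF assms(1-5)] r by (smt (verit) pole_pos divide_pos_pos zero_less_power)
  have low: "r\<^sup>2 * (\<Sum>j<J. ?N j) < r\<^sup>2 * ?N J / 2"
  proof (cases "J = 0")
    case False
    with lo have Jr: "pole J \<le> 10 * r" by simp
    have "r\<^sup>2 * (\<Sum>j<J. ?N j) \<le> (\<Sum>j<J. 34 / 27 * pole j)"
      unfolding sum_distrib_left
    proof (rule sum_mono)
      fix j assume "j \<in> {..<J}"
      then show "r\<^sup>2 * ?N j \<le> 34 / 27 * pole j"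
        using pole_less[of j J] Jr assms(5) r
        by (intro norm_quot_inner[OF assms(1-4)]) auto
    qed
    also have "\<dots> = 34 / 27 * (\<Sum>j<J. pole j)" by (simp add: sum_distrib_left)
    also have "\<dots> < pole J / 242" using sum_pole_less[of J] pole_pos(1)[of J] by linarith
    also have "pole J / 121 \<le> r\<^sup>2 * (pole J / (r + pole J)\<^sup>2)"
    proof -
      have "(r + pole J)\<^sup>2 \<le> (11 * r)\<^sup>2" using r Jr by (intro power_mono) auto
      then have "pole J * r\<^sup>2 / (121 * r\<^sup>2) \<le> pole J * r\<^sup>2 / (r + pole J)\<^sup>2"
        using r by (intro divide_left_mono mult_pos_pos zero_less_power)
          (auto simp: power_mult_distrib intro: add_pos_pos)
      then show ?thesis using r by (simp add: mult.commute)
    qed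
    then have "pole J / 242 \<le> r\<^sup>2 * ?N J / 2"
      using mult_left_mono[OF norm_quot_ge[OF assms(1-5)] zero_le_power2[of r]] by linarith
    finally show ?thesis .
  qed (use pos r in auto)
  have high: "(\<Sum>j\<in>{J<..m}. ?N j) < ?N J / 2"
  proof (cases "J = m")
    case False
    with hi have Jr: "r \<le> 10 * pole J" by simp
    have "(\<Sum>j\<in>{J<..m}. ?N j) \<le> (\<Sum>j\<in>{J<..m}. 34 / 27 / pole j)"
    proof (rule sum_mono)
      fix j assume j: "j \<in> {J<..m}"
      then have "1000 * pole J \<le> pole j" by (intro pole_less) auto
      then have "10 * r \<le> pole j" using Jr pole_pos(1)[of J] by linarith
      with j show "?N j \<le> 34 / 27 / pole j"
        by (intro norm_quot_outer[OF assms(1-4)]) auto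
    qed
    also have "\<dots> = 34 / 27 * (\<Sum>j\<in>{J<..m}. 1 / pole j)" by (simp add: sum_distrib_left)
    also have "\<dots> < 1 / pole J / 242"
    proof -
      have *: "34 / 27 * s < t / 242" if "999 * s \<le> t" "0 < t" for s t :: real
        using that by linarith
      show ?thesis by (intro * sum_inverse_pole_le divide_pos_pos) auto
    qed
    also have "1 / pole J / 121 \<le> pole J / (r + pole J)\<^sup>2"
    proof -
      have "(r + pole J)\<^sup>2 \<le> (11 * pole J)\<^sup>2" using r Jr by (intro power_mono) auto
      then have "pole J / (11 * pole J)\<^sup>2 \<le> pole J / (r + pole J)\<^sup>2"
        using r by (intro divide_left_mono mult_pos_pos zero_less_power) (auto intro: add_pos_pos)
      then show ?thesis by (simp add: power2_eq_square)
    qed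
    then have "1 / pole J / 121 \<le> ?N J"
      using norm_quot_ge[OF assms(1-5)] by (rule order_trans)
    then have "1 / pole J / 242 \<le> ?N J / 2" by simp
    finally show ?thesis .
  qed (use pos in auto)
  have "norm (\<Sum>j<J. chord m j z w) \<le> r\<^sup>2 * (\<Sum>j<J. ?N j)"
    unfolding sum_distrib_left by (rule sum_norm_le) (simp add: norm_chord assms(3,4) power2_eq_square)
  moreover have "norm (\<Sum>j\<in>{J<..m}. chord m j z w) \<le> r\<^sup>2 * (\<Sum>j\<in>{J<..m}. ?N j)"
    unfolding sum_distrib_left by (rule sum_norm_le) (simp add: norm_chord assms(3,4) power2_eq_square)
  moreover have "r\<^sup>2 * (\<Sum>j\<in>{J<..m}. ?N j) < r\<^sup>2 * (?N J / 2)"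
    using high r by (intro mult_strict_left_mono) auto
  ultimately have small: "norm (\<Sum>j<J. chord m j z w) + norm (\<Sum>j\<in>{J<..m}. chord m j z w)
      < norm (chord m J z w)"
    using low by (simp add: norm_chord assms(3,4) power2_eq_square)
  show ?thesis
  proof
    assume "(\<Sum>j\<le>m. chord m j z w) = 0"
    moreover have "chord m J z w = (\<Sum>j\<le>m. chord m j z w)
        - ((\<Sum>j<J. chord m j z w) + (\<Sum>j\<in>{J<..m}. chord m j z w))"
      unfolding sum_split_at[OF assms(5)] by simp
    ultimately have "chord m J z w
        = - ((\<Sum>j<J. chord m j z w) + (\<Sum>j\<in>{J<..m}. chord m j z w))" by simp
    then have "norm (chord m J z w)
        = norm ((\<Sum>j<J. chord m j z w) + (\<Sum>j\<in>{J<..m}. chord m j z w))"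
      by (metis norm_minus_cancel)
    with small norm_triangle_ineq[of "\<Sum>j<J. chord m j z w" "\<Sum>j\<in>{J<..m}. chord m j z w"]
    show False by linarith
  qed
qed

text \<open>Terms \<open>J\<close> and \<open>Suc J\<close> may have equal size here. The inner one
  is nearly \<open>p / z\<close>, the outer one nearly affine, and exactly one of the two is
  conjugated. As conjugation is \<open>z \<mapsto> r^2 / z\<close> on the circle, both chords are
  nearly positive multiples of one unit vector \<open>e\<close>, so they cannot cancel.\<close>

lemma sum_chord_nonzero_between:
  assumes "z \<in> regular m" "w \<in> regular m" "norm z = r" "norm w = r" "J < m"
    and lo: "10 * pole J \<le> r" and hi: "10 * r \<le> pole (Suc J)"
  shows "(\<Sum>j\<le>m. chord m j z w) \<noteq> 0"
proof -
  have r: "r > 0" using regularD(1)[OF assms(1)] assms(3) by auto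
  have nz: "z \<noteq> 0" "w \<noteq> 0" using regularD(1) assms by auto
  \<comment> \<open>For even \<open>J\<close> the chords are close to
    \<open>\<alpha> * z * w / r^2\<close> and to \<open>z * w / pole (Suc J)\<close>, which is
    \<open>\<beta>\<close> times the same unit vector. For odd \<open>J\<close> they are close to
    the positive reals \<open>\<alpha>\<close> and \<open>\<beta>\<close> themselves.\<close>
  define e where "e = (if even J then z * w / of_real (r\<^sup>2) else 1)"
  have e: "norm e = 1" using r assms(3,4)
    by (simp add: e_def norm_divide norm_mult power2_eq_square)
  define \<alpha> where "\<alpha> = pole J"
  define \<beta> where "\<beta> = r\<^sup>2 / pole (Suc J)"
  have ab: "\<alpha> > 0" "\<beta> > 0" using r by (simp_all add: \<alpha>_def \<beta>_def)
  have zw: "z * w * cnj (z * w) = of_real (r\<^sup>2 * r\<^sup>2)"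
    using complex_norm_square[of "z * w"] assms(3,4) by (simp add: norm_mult power2_eq_square)
  have A: "norm (chord m J z w - of_real \<alpha> * e) \<le> 7 / 27 * \<alpha>"
  proof (cases "even J")
    case True
    have "of_real (r\<^sup>2) * (chord m J z w - of_real \<alpha> * e)
        = (z * w) * cnj (z * w * quot m J z w - of_real \<alpha>)"
    proof -
      have "of_real (r\<^sup>2) * chord m J z w = (z * w) * cnj (z * w) * cnj (quot m J z w)"
        unfolding zw using True assms(3,4) by (simp add: chord_def power2_eq_square)
      moreover have "of_real (r\<^sup>2) * e = z * w"
        using True r by (simp add: e_def)
      moreover have "of_real (r\<^sup>2) * (chord m J z w - of_real \<alpha> * e)
          = of_real (r\<^sup>2) * chord m J z w - of_real \<alpha> * (of_real (r\<^sup>2) * e)"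
        by (simp only: right_diff_distrib mult.left_commute)
      ultimately show ?thesis by (simp only:) (simp add: algebra_simps)
    qed
    then have "r\<^sup>2 * norm (chord m J z w - of_real \<alpha> * e)
        = r\<^sup>2 * norm (z * w * quot m J z w - of_real \<alpha>)"
      using assms(3,4) r 
      by (metis complex_mod_cnj norm_mult norm_of_real abs_of_nonneg power2_eq_square zero_le_power2)
    then have "norm (chord m J z w - of_real \<alpha> * e) = norm (z * w * quot m J z w - of_real \<alpha>)"
      using r by simp
    then show ?thesis using quot_inner[OF assms(1-5) lo] by (simp add: \<alpha>_def)
  next
    case False
    then show ?thesis using quot_inner[OF assms(1-5) lo]
      by (simp add: \<alpha>_def e_def chord_def)
  qed
  have outer: "norm (quot m (Suc J) z w - of_real (1 / pole (Suc J))) \<le> 7 / 27 / pole (Suc J)"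
    using quot_outer[OF assms(1-4) _ _ hi] assms(5) by auto
  have scale: "r\<^sup>2 * norm (quot m (Suc J) z w - of_real (1 / pole (Suc J))) \<le> 7 / 27 * \<beta>"
    using mult_left_mono[OF outer, of "r\<^sup>2"] by (simp add: \<beta>_def)
  have B: "norm (chord m (Suc J) z w - of_real \<beta> * e) \<le> 7 / 27 * \<beta>"
  proof (cases "even J")
    case True
    then have "chord m (Suc J) z w - of_real \<beta> * e
        = z * w * (quot m (Suc J) z w - of_real (1 / pole (Suc J)))"
      using r by (simp add: \<beta>_def e_def chord_def algebra_simps)
    then have "norm (chord m (Suc J) z w - of_real \<beta> * e)
        = r\<^sup>2 * norm (quot m (Suc J) z w - of_real (1 / pole (Suc J)))"
      using assms(3,4) by (simp only: norm_mult power2_eq_square)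
    with scale show ?thesis by simp
  next
    case False
    then have "chord m (Suc J) z w - of_real \<beta> * e
        = of_real (r\<^sup>2) * cnj (quot m (Suc J) z w - of_real (1 / pole (Suc J)))"
      using assms(3,4) by (simp add: \<beta>_def e_def chord_def algebra_simps power2_eq_square)
    then have "norm (chord m (Suc J) z w - of_real \<beta> * e)
        = r\<^sup>2 * norm (quot m (Suc J) z w - of_real (1 / pole (Suc J)))"
      using r by (simp only: norm_mult complex_mod_cnj norm_of_real) simp
    with scale show ?thesis by simp
  qed
  have low: "norm (\<Sum>j<J. chord m j z w) \<le> \<alpha> / 100"
  proof -
    have "norm (\<Sum>j<J. chord m j z w) \<le> (\<Sum>j<J. 34 / 27 * pole j)"
    proof (rule sum_norm_le)
      fix j assume "j \<in> {..<J}"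
      then show "norm (chord m j z w) \<le> 34 / 27 * pole j"
        using pole_mono[of j J] lo assms(5) norm_quot_inner[OF assms(1-4), of j]
        by (simp add: norm_chord assms(3,4) power2_eq_square)
    qed
    also have "\<dots> = 34 / 27 * (\<Sum>j<J. pole j)" by (simp add: sum_distrib_left)
    also have "\<dots> \<le> \<alpha> / 100" using sum_pole_less[of J] ab unfolding \<alpha>_def by linarith
    finally show ?thesis .
  qed
  have high: "norm (\<Sum>j\<in>{Suc J<..m}. chord m j z w) \<le> \<beta> / 100"
  proof -
    have "norm (\<Sum>j\<in>{Suc J<..m}. chord m j z w) \<le> (\<Sum>j\<in>{Suc J<..m}. r\<^sup>2 * (34 / 27 / pole j))"
    proof (rule sum_norm_le)
      fix j assume j: "j \<in> {Suc J<..m}"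
      then have "norm (quot m j z w) \<le> 34 / 27 / pole j"
        using pole_mono[of "Suc J" j] hi by (intro norm_quot_outer[OF assms(1-4)]) auto
      then show "norm (chord m j z w) \<le> r\<^sup>2 * (34 / 27 / pole j)"
        unfolding norm_chord assms(3,4) power2_eq_square by (rule mult_left_mono) simp
    qed
    also have "\<dots> = 34 / 27 * r\<^sup>2 * (\<Sum>j\<in>{Suc J<..m}. 1 / pole j)"
      unfolding sum_distrib_left by (rule sum.cong) auto
    also have "\<dots> \<le> 34 / 27 * r\<^sup>2 * (1 / pole (Suc J) / 999)"
      using sum_inverse_pole_le[of "Suc J" m] by (intro mult_left_mono) auto
    also have "\<dots> = 34 / 27 / 999 * \<beta>" by (simp add: \<beta>_def)
    also have "\<dots> \<le> \<beta> / 100" using ab by simp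
    finally show ?thesis .
  qed
  have split: "(\<Sum>j\<le>m. chord m j z w) = (\<Sum>j<J. chord m j z w) + chord m J z w
      + chord m (Suc J) z w + (\<Sum>j\<in>{Suc J<..m}. chord m j z w)"
    using sum_split_at[of "Suc J" m] assms(5) by (simp add: lessThan_Suc add.commute)
  show ?thesis
  proof
    assume "(\<Sum>j\<le>m. chord m j z w) = 0"
    then have "of_real (\<alpha> + \<beta>) * e = - ((chord m J z w - of_real \<alpha> * e)
        + (chord m (Suc J) z w - of_real \<beta> * e)
        + (\<Sum>j<J. chord m j z w) + (\<Sum>j\<in>{Suc J<..m}. chord m j z w))"
      unfolding split by (simp add: algebra_simps add_eq_0_iff2)
    then have "norm (of_real (\<alpha> + \<beta>) * e) = norm ((chord m J z w - of_real \<alpha> * e)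
        + (chord m (Suc J) z w - of_real \<beta> * e)
        + (\<Sum>j<J. chord m j z w) + (\<Sum>j\<in>{Suc J<..m}. chord m j z w))"
      by (metis norm_minus_cancel)
    \<comment> \<open>The main terms add up to length \<open>\<alpha> + \<beta>\<close>, and all
      errors together stay below a third of it.\<close>
    also have "\<dots> \<le> 7 / 27 * \<alpha> + 7 / 27 * \<beta> + \<alpha> / 100 + \<beta> / 100"
      using A B low high by (intro norm_triangle_mono) auto
    also have "norm (of_real (\<alpha> + \<beta>) * e) = \<alpha> + \<beta>"
      using e ab by (simp only: norm_mult norm_of_real) simp
    finally show False using ab by simp
  qed
qed

text \<open>Let \<open>J\<close> be the last index with \<open>pole J \<le> 10 * r\<close>, or
  \<open>0\<close> if there is none. Then \<open>pole (Suc J)\<close> is far outside the circle, and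
  either \<open>pole J\<close> is near it, or far inside it. These are the two cases treated
  above.\<close>

lemma sum_chord_nonzero:
  assumes "z \<in> regular m" "w \<in> regular m" "norm z = norm w"
  shows "(\<Sum>j\<le>m. chord m j z w) \<noteq> 0"
proof -
  define r where "r = norm w"
  define J where "J = (GREATEST j. j \<le> m \<and> (j = 0 \<or> pole j \<le> 10 * r))"
  have J: "J \<le> m \<and> (J = 0 \<or> pole J \<le> 10 * r)"
    unfolding J_def by (rule GreatestI_nat[of _ 0 m]) auto
  have max: "pole (Suc J) > 10 * r" if "Suc J \<le> m"
  proof (rule ccontr)
    assume "\<not> pole (Suc J) > 10 * r"
    with that have "Suc J \<le> J"
      unfolding J_def[symmetric] 
      by (subst (2) J_def) (rule Greatest_le_nat[of _ _ m], auto)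
    then show False by simp
  qed
  have eq: "norm z = r" "norm w = r" using assms(3) by (simp_all add: r_def)
  show ?thesis
  proof (cases "J = m \<or> r \<le> 10 * pole J")
    case True
    then show ?thesis using sum_chord_nonzero_dominant[OF assms(1,2) eq, of J] J by blast
  next
    case False
    then have "J < m" using J by auto
    with False max show ?thesis
      by (intro sum_chord_nonzero_between[OF assms(1,2) eq, of J]) auto
  qed
qed

section \<open>The surface in the finite chart\<close>

text \<open>The horizontal projection, as a complex number, is
  \<open>hpart m z + cnj (kpart m z)\<close>; the sign of the antiholomorphic terms is part of
  \<open>kpart\<close>.\<close>

definition hpart :: "nat \<Rightarrow> complex \<Rightarrow> complex" where
  "hpart m z = (\<Sum>j | j \<le> m \<and> odd j. pot m j z)"

definition kpart :: "nat \<Rightarrow> complex \<Rightarrow> complex" where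
  "kpart m z = - (\<Sum>j | j \<le> m \<and> even j. pot m j z)"

definition hder :: "nat \<Rightarrow> complex \<Rightarrow> complex" where
  "hder m z = - (\<Sum>j | j \<le> m \<and> odd j. quot m j z z)"

definition kder :: "nat \<Rightarrow> complex \<Rightarrow> complex" where
  "kder m z = (\<Sum>j | j \<le> m \<and> even j. quot m j z z)"

lemma pot_has_field_derivative:
  assumes "z \<in> regular m" "j \<le> m"
  shows "(pot m j has_field_derivative - quot m j z z) (at z)"
proof -
  consider "j = 0" | "j \<noteq> 0" "j = m" | "1 \<le> j" "j < m" using assms(2) by linarith
  then show ?thesis
  proof cases
    case 1
    have "((\<lambda>z. 1 / z) has_field_derivative - (1 / (z * z))) (at z)"
      using regularD(1)[OF assms(1)]
      by (auto intro!: derivative_eq_intros simp: divide_simps)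
    with 1 show ?thesis by (simp add: pot_def[abs_def] quot_def)
  next
    case 2
    have "((\<lambda>z. - z / of_real (pole m)) has_field_derivative - (1 / of_real (pole m))) (at z)"
      by (auto intro!: derivative_eq_intros simp: divide_simps)
    with 2 show ?thesis by (simp add: pot_def[abs_def] quot_def)
  next
    case 3
    then have "z - of_real (pole j) \<noteq> 0" using regularD(2)[OF assms(1)] by auto
    then have "((\<lambda>z. of_real (pole j) / (z - of_real (pole j))) has_field_derivative
        - (of_real (pole j) / ((z - of_real (pole j)) * (z - of_real (pole j))))) (at z)"
      by (auto intro!: derivative_eq_intros simp: divide_simps)
    with 3 show ?thesis by (simp add: pot_def[abs_def] quot_def)
  qed
qed

lemma hpart_has_field_derivative [derivative_intros]:
  assumes "z \<in> regular m"
  shows "(hpart m has_field_derivative hder m z) (at z)"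
  unfolding hpart_def[abs_def] hder_def sum_negf[symmetric]
  by (intro DERIV_sum pot_has_field_derivative assms) auto

lemma kpart_has_field_derivative [derivative_intros]:
  assumes "z \<in> regular m"
  shows "(kpart m has_field_derivative kder m z) (at z)"
proof -
  have "((\<lambda>z. \<Sum>j | j \<le> m \<and> even j. pot m j z) has_field_derivative
      (\<Sum>j | j \<le> m \<and> even j. - quot m j z z)) (at z)"
    by (intro DERIV_sum pot_has_field_derivative assms) auto
  from DERIV_minus[OF this] show ?thesis
    by (simp add: kpart_def[abs_def] kder_def sum_negf)
qed

lemma sum_chord_eq:
  assumes "norm z = norm w"
  shows "(\<Sum>j\<le>m. chord m j z w) = z * w * (\<Sum>j | j \<le> m \<and> odd j. quot m j z w)
    + of_real ((norm z)\<^sup>2) * cnj (\<Sum>j | j \<le> m \<and> even j. quot m j z w)"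
proof -
  have "(\<Sum>j\<le>m. chord m j z w) = (\<Sum>j | j \<le> m \<and> odd j. chord m j z w)
      + (\<Sum>j | j \<le> m \<and> even j. chord m j z w)"
    by (subst sum.union_disjoint[symmetric]) (auto intro: sum.cong)
  also have "(\<Sum>j | j \<le> m \<and> odd j. chord m j z w) = z * w * (\<Sum>j | j \<le> m \<and> odd j. quot m j z w)"
    unfolding sum_distrib_left by (rule sum.cong) (auto simp: chord_def)
  also have "(\<Sum>j | j \<le> m \<and> even j. chord m j z w)
      = of_real ((norm z)\<^sup>2) * cnj (\<Sum>j | j \<le> m \<and> even j. quot m j z w)"
    unfolding sum_distrib_left cnj_sum
    by (rule sum.cong) (auto simp: chord_def assms power2_eq_square)
  finally show ?thesis .
qed

text \<open>On the circle \<open>cnj z = r^2 / z\<close>, hence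
  \<open>cnj (w - z) = - r^2 * (w - z) / (z * w)\<close>. This turns the difference of the two image
  points into \<open>(w - z) / (z * w)\<close> times the sum of the chords, which does not
  vanish.\<close>

lemma level_curve_inj:
  assumes "z \<in> regular m" "w \<in> regular m" "norm z = norm w"
    and eq: "hpart m z + cnj (kpart m z) = hpart m w + cnj (kpart m w)"
  shows "z = w"
proof (rule ccontr)
  assume "z \<noteq> w"
  define A where "A = (\<Sum>j | j \<le> m \<and> odd j. quot m j z w)"
  define B where "B = (\<Sum>j | j \<le> m \<and> even j. quot m j z w)"
  have h: "hpart m z - hpart m w = (w - z) * A"
    unfolding hpart_def A_def sum_subtractf[symmetric] sum_distrib_left
    by (rule sum.cong) (auto simp: pot_diff assms)
  have "kpart m w - kpart m z = (\<Sum>j | j \<le> m \<and> even j. pot m j z - pot m j w)"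
    by (simp add: kpart_def sum_subtractf)
  also have "\<dots> = (w - z) * B"
    unfolding B_def sum_distrib_left by (rule sum.cong) (auto simp: pot_diff assms)
  finally have k: "cnj (kpart m w) - cnj (kpart m z) = cnj (w - z) * cnj B"
    by (metis complex_cnj_diff complex_cnj_mult)
  have e: "(w - z) * A = cnj (w - z) * cnj B"
    using eq unfolding h[symmetric] k[symmetric] by (simp add: algebra_simps)
  have "of_real ((norm z)\<^sup>2) = z * cnj z" "of_real ((norm z)\<^sup>2) = w * cnj w"
    using complex_norm_square[of z] complex_norm_square[of w] assms(3) by simp_all
  then have c: "z * w * cnj (w - z) = - of_real ((norm z)\<^sup>2) * (w - z)"
    by (simp add: algebra_simps)
  have "(w - z) * (z * w * A + of_real ((norm z)\<^sup>2) * cnj B)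
      = z * w * ((w - z) * A) + of_real ((norm z)\<^sup>2) * (w - z) * cnj B"
    by (simp add: algebra_simps)
  also have "\<dots> = z * w * cnj (w - z) * cnj B + of_real ((norm z)\<^sup>2) * (w - z) * cnj B"
    unfolding e by (simp only: mult.assoc)
  also have "\<dots> = 0" unfolding c by simp
  finally have "(w - z) * (z * w * A + of_real ((norm z)\<^sup>2) * cnj B) = 0" .
  then have "(\<Sum>j\<le>m. chord m j z w) = 0"
    using \<open>z \<noteq> w\<close> sum_chord_eq[OF assms(3), of m] by (simp add: A_def B_def)
  with sum_chord_nonzero[OF assms(1-3)] show False by simp
qed

text \<open>The direction \<open>\<i> * z\<close> is tangent to the circle through \<open>z\<close>,
  and its image is \<open>- \<i> / z\<close> times the sum of the chords at
  \<open>w = z\<close>.\<close>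

lemma level_curve_immersed:
  assumes "z \<in> regular m"
  shows "hder m z * (\<i> * z) + cnj (kder m z * (\<i> * z)) \<noteq> 0"
proof
  define A where "A = (\<Sum>j | j \<le> m \<and> odd j. quot m j z z)"
  define B where "B = (\<Sum>j | j \<le> m \<and> even j. quot m j z z)"
  assume "hder m z * (\<i> * z) + cnj (kder m z * (\<i> * z)) = 0"
  moreover have "hder m z * (\<i> * z) + cnj (kder m z * (\<i> * z)) = - \<i> * (z * A + cnj z * cnj B)"
    by (simp add: hder_def kder_def A_def B_def algebra_simps)
  ultimately have "- \<i> * (z * A + cnj z * cnj B) = 0" by (simp only:)
  then have "z * (z * A + cnj z * cnj B) = 0" by simp
  then have "z * z * A + (z * cnj z) * cnj B = 0"
    by (simp only: distrib_left mult.assoc)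
  then have "(\<Sum>j\<le>m. chord m j z z) = 0"
    using sum_chord_eq[OF refl, of m z] complex_norm_square[of z] by (simp add: A_def B_def)
  with sum_chord_nonzero[OF assms assms refl] show False by simp
qed

section \<open>The parametrization and its Weierstrass data\<close>

definition surf :: "nat \<Rightarrow> complex \<Rightarrow> real ^ 3" where
  "surf m z = vector [Re (hpart m z + kpart m z), Im (hpart m z - kpart m z), ln (norm z)]"

text \<open>Coefficients of the three forms with respect to \<open>z\<close>. The second coordinate
  of \<open>h + cnj k\<close> is \<open>Im (h - k) = Re (- \<i> * (h - k))\<close>, which explains
  the factor \<open>- \<i>\<close>.\<close>

definition phi :: "nat \<Rightarrow> 3 \<Rightarrow> complex \<Rightarrow> complex" where
  "phi m i z = (if i = 1 then hder m z + kder m z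
                else if i = 2 then - \<i> * (hder m z - kder m z) else 1 / z)"

lemma surf_inj: "inj_on (surf m) (regular m)"
proof (rule inj_onI)
  fix z w assume zw: "z \<in> regular m" "w \<in> regular m" "surf m z = surf m w"
  have nz: "z \<noteq> 0" "w \<noteq> 0" using zw regularD by auto
  have c: "surf m z $ 1 = surf m w $ 1" "surf m z $ 2 = surf m w $ 2" "surf m z $ 3 = surf m w $ 3"
    using zw(3) by simp_all
  have "norm z = norm w" using c(3) nz by (simp add: surf_def)
  moreover have "hpart m z + cnj (kpart m z) = hpart m w + cnj (kpart m w)"
    using c(1,2) by (simp add: surf_def complex_eq_iff)
  ultimately show "z = w" using level_curve_inj zw by blast
qed

lemma ln_norm_has_derivative:
  assumes "z \<noteq> (0 :: complex)"
  shows "((\<lambda>z. ln (norm z)) has_derivative (\<lambda>v. Re (1 / z * v))) (at z)"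
proof -
  \<comment> \<open>Division by \<open>z\<close> moves the base point to \<open>1\<close>, away from
    the branch cut; the real part only changes by the constant \<open>ln (norm z)\<close>.\<close>
  have "((\<lambda>u. Ln (u / z)) has_field_derivative 1 / z) (at z)"
    using assms by (auto intro!: derivative_eq_intros)
  then have "((\<lambda>u. Re (Ln (u / z)) + ln (norm z)) has_derivative (\<lambda>v. Re (1 / z * v))) (at z)"
    unfolding has_field_derivative_def by (auto intro!: derivative_eq_intros)
  then show ?thesis
  proof (rule has_derivative_transform_within_open)
    show "open (- {0::complex})" by auto
  next
    fix u :: complex assume "u \<in> - {0}"
    then show "Re (Ln (u / z)) + ln (norm z) = ln (norm u)"
      using assms by (simp add: norm_divide ln_div)
  qed (use assms in auto)
qed

lemma surf_nth_has_derivative: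
  assumes "z \<in> regular m"
  shows "((\<lambda>z. surf m z $ i) has_derivative (\<lambda>v. Re (phi m i z * v))) (at z)"
proof -
  note h = hpart_has_field_derivative[OF assms, unfolded has_field_derivative_def]
  note k = kpart_has_field_derivative[OF assms, unfolded has_field_derivative_def]
  consider "i = 1" | "i = 2" | "i = 3" using exhaust_3 by blast
  then show ?thesis
  proof cases
    case 1
    have "((\<lambda>z. Re (hpart m z + kpart m z)) has_derivative
        (\<lambda>v. Re (hder m z * v + kder m z * v))) (at z)"
      by (intro has_derivative_Re has_derivative_add h k)
    with 1 show ?thesis by (simp add: surf_def phi_def algebra_simps)
  next
    case 2
    have "((\<lambda>z. Im (hpart m z - kpart m z)) has_derivative
        (\<lambda>v. Im (hder m z * v - kder m z * v))) (at z)"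
      by (intro has_derivative_Im has_derivative_diff h k)
    with 2 show ?thesis by (simp add: surf_def phi_def algebra_simps)
  next
    case 3
    then show ?thesis using ln_norm_has_derivative[OF regularD(1)[OF assms]]
      by (simp add: surf_def phi_def)
  qed
qed

lemma surf_has_derivative:
  assumes "z \<in> regular m"
  shows "(surf m has_derivative (\<lambda>v. \<chi> i. Re (phi m i z * v))) (at z)"
  unfolding has_derivative_componentwise_within[of "surf m"]
  using surf_nth_has_derivative[OF assms] by (auto simp: Basis_vec_def inner_axis)

lemma surf_derivative_inj:
  assumes "z \<in> regular m"
  shows "inj (\<lambda>v. \<chi> i. Re (phi m i z * v))"
proof -
  have lin: "linear (\<lambda>v. \<chi> i. Re (phi m i z * v))"
    using surf_has_derivative[OF assms] has_derivative_linear by blast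
  show ?thesis unfolding linear_injective_0[OF lin]
  proof (intro allI impI)
    fix v assume v: "(\<chi> i. Re (phi m i z * v)) = 0"
    have nz: "z \<noteq> 0" using regularD assms by auto
    have r: "Re (phi m i z * v) = 0" for i
      using v by (simp add: vec_eq_iff)
    \<comment> \<open>A kernel vector does not change the height, so it is a real multiple of the
      tangent \<open>\<i> * z\<close> of the circle, and the immersed level curve forces it to be
      zero.\<close>
    have "Re (v / z) = 0" using r[of 3] by (simp add: phi_def)
    then have "v / z = \<i> * of_real (Im (v / z))" by (simp add: complex_eq_iff)
    then obtain t where t: "v = of_real t * (\<i> * z)"
      using nz by (simp add: divide_eq_eq) (metis mult.assoc mult.commute)
    have "hder m z * v + cnj (kder m z * v) = 0"
      using r[of 1] r[of 2] by (simp add: phi_def complex_eq_iff algebra_simps)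
    then have "of_real t * (hder m z * (\<i> * z) + cnj (kder m z * (\<i> * z))) = 0"
      unfolding t by (simp add: algebra_simps)
    then have "t = 0" using level_curve_immersed[OF assms] by simp
    then show "v = 0" using t by simp
  qed
qed

section \<open>The Riemann sphere\<close>

definition riemann_sphere :: "complex option topology" where
  "riemann_sphere = Alexandroff_compactification euclidean"

lemma topspace_riemann_sphere [simp]: "topspace riemann_sphere = UNIV"
  by (auto simp: riemann_sphere_def UNIV_option_conv)

lemma openin_riemann_sphere:
  "openin riemann_sphere V \<longleftrightarrow> open (Some -` V) \<and> (None \<in> V \<longrightarrow> bounded (- (Some -` V)))"
proof
  assume "openin riemann_sphere V"
  then consider U where "open U" "V = Some ` U"
    | C where "compact C" "closed C" "V = insert None (Some ` (UNIV - C))"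
    by (auto simp: riemann_sphere_def openin_Alexandroff_compactification)
  then show "open (Some -` V) \<and> (None \<in> V \<longrightarrow> bounded (- (Some -` V)))"
  proof cases
    case 1
    then have "Some -` V = U" by auto
    with 1 show ?thesis by auto
  next
    case 2
    then have "Some -` V = - C" by auto
    with 2 show ?thesis by (auto simp: compact_imp_bounded)
  qed
next
  assume V: "open (Some -` V) \<and> (None \<in> V \<longrightarrow> bounded (- (Some -` V)))"
  show "openin riemann_sphere V"
  proof (cases "None \<in> V")
    case True
    then have "V = insert None (Some ` (UNIV - - (Some -` V)))"
      by (auto simp: image_iff)
    moreover have "compact (- (Some -` V))" "closed (- (Some -` V))"
      using V True by (auto simp: compact_eq_bounded_closed)
    ultimately show ?thesis
      unfolding riemann_sphere_def openin_Alexandroff_compactification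
      by (metis compactin_euclidean_iff closed_closedin topspace_euclidean)
  next
    case False
    then have "V = Some ` (Some -` V)"
      by (auto simp: image_iff) (metis not_None_eq)
    with V show ?thesis
      unfolding riemann_sphere_def openin_Alexandroff_compactification by (metis open_openin)
  qed
qed

lemma compact_riemann_sphere: "compact_space riemann_sphere"
  by (simp add: riemann_sphere_def)

lemma Hausdorff_riemann_sphere: "Hausdorff_space riemann_sphere"
proof -
  have "locally_compact_space (euclidean :: complex topology)"
    unfolding locally_compact_space_def
  proof safe
    fix x :: complex
    show "\<exists>U K. openin euclidean U \<and> compactin euclidean K \<and> x \<in> U \<and> U \<subseteq> K"
      by (intro exI[of _ "ball x 1"] exI[of _ "cball x 1"]) auto
  qed
  then show ?thesis
    by (simp add: riemann_sphere_def Hausdorff_space_Alexandroff_compactification)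
qed

text \<open>The plane is connected, and it is dense in its one-point compactification because it is
  not compact.\<close>

lemma connected_riemann_sphere: "connected_space riemann_sphere"
proof -
  have "connectedin riemann_sphere (range Some)"
    unfolding riemann_sphere_def
    by (rule connectedin_continuous_map_image[OF continuous_map_Some])
      (simp add: connectedin_iff_connected connected_UNIV)
  moreover have "\<not> compact_space (euclidean :: complex topology)"
    by (simp add: compact_space_def not_compact_UNIV)
  then have "riemann_sphere closure_of (range Some) = topspace riemann_sphere"
    using Alexandroff_compactification_dense[of "euclidean :: complex topology"]
    by (simp add: riemann_sphere_def)
  ultimately show ?thesis
    by (metis connectedin_closure_of connectedin_topspace)
qed

lemma continuous_map_riemann_sphere:
  fixes f :: "complex option \<Rightarrow> 'a::topological_space"
  assumes "continuous_on UNIV (\<lambda>z. f (Some z))"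
    and "((\<lambda>z. f (Some z)) \<longlongrightarrow> f None) at_infinity"
  shows "continuous_map riemann_sphere euclidean f"
  unfolding continuous_map_def
proof (intro conjI allI impI)
  fix W assume W: "openin euclidean (W :: 'a set)"
  then have "open ((\<lambda>z. f (Some z)) -` W)"
    using assms(1) by (simp add: continuous_on_open_vimage)
  moreover have "bounded (- ((\<lambda>z. f (Some z)) -` W))" if "f None \<in> W"
  proof -
    have "\<forall>\<^sub>F z in at_infinity. f (Some z) \<in> W"
      using assms(2) W that by (auto dest: topological_tendstoD)
    then obtain b where "\<And>z. b \<le> norm z \<Longrightarrow> f (Some z) \<in> W"
      by (auto simp: eventually_at_infinity)
    then have "- ((\<lambda>z. f (Some z)) -` W) \<subseteq> cball 0 b" by force
    then show ?thesis using bounded_cball bounded_subset by blast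
  qed
  moreover have "Some -` {x \<in> topspace riemann_sphere. f x \<in> W} = (\<lambda>z. f (Some z)) -` W" by auto
  ultimately show "openin riemann_sphere {x \<in> topspace riemann_sphere. f x \<in> W}"
    unfolding openin_riemann_sphere by simp
qed auto

section \<open>Charts\<close>

text \<open>By the convention \<open>1 / 0 = 0\<close> the points \<open>Some 0\<close> and
  \<open>None\<close> receive the same value. A chart built from this map must therefore omit
  \<open>Some 0\<close>, whence the condition \<open>0 \<in> E\<close> in what follows.\<close>

fun inv_coord :: "complex option \<Rightarrow> complex" where
  "inv_coord None = 0"
| "inv_coord (Some z) = 1 / z"

definition inv_point :: "complex \<Rightarrow> complex option" where
  "inv_point \<zeta> = (if \<zeta> = 0 then None else Some (1 / \<zeta>))"

definition finite_chart :: "complex option chart" where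
  "finite_chart = (range Some, the)"

text \<open>In the atlas of the surface \<open>E\<close> consists of all finite ends, not of the
  origin alone. Each end then lies in exactly one chart, so \<open>chart_at\<close> is determined
  there although it is an arbitrary choice at regular points.\<close>

definition infinity_chart :: "complex set \<Rightarrow> complex option chart" where
  "infinity_chart E = (- (Some ` E), inv_coord)"

lemma image_inv_coord:
  assumes "0 \<in> E"
  shows "inv_coord ` (- (Some ` E)) = {\<zeta>. \<zeta> = 0 \<or> 1 / \<zeta> \<notin> E}"
proof (intro Set.set_eqI iffI)
  fix \<zeta> assume "\<zeta> \<in> {\<zeta>. \<zeta> = 0 \<or> 1 / \<zeta> \<notin> E}"
  then have "inv_point \<zeta> \<in> - (Some ` E)" "\<zeta> = inv_coord (inv_point \<zeta>)"
    by (auto simp: inv_point_def)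
  then show "\<zeta> \<in> inv_coord ` (- (Some ` E))" by blast
next
  fix \<zeta> assume "\<zeta> \<in> inv_coord ` (- (Some ` E))"
  then obtain p where "p \<notin> Some ` E" "\<zeta> = inv_coord p" by auto
  then show "\<zeta> \<in> {\<zeta>. \<zeta> = 0 \<or> 1 / \<zeta> \<notin> E}" by (cases p) auto
qed

lemma open_image_inv_coord:
  assumes "finite E" "0 \<in> E"
  shows "open (inv_coord ` (- (Some ` E)))"
proof -
  have "{\<zeta>. \<zeta> = 0 \<or> 1 / \<zeta> \<notin> E} = - ((\<lambda>z. 1 / z) ` (E - {0}))"
  proof -
    have "\<zeta> \<in> (\<lambda>z. 1 / z) ` (E - {0})" if "\<zeta> \<noteq> 0" "1 / \<zeta> \<in> E" for \<zeta>
      using that by (intro image_eqI[of _ _ "1 / \<zeta>"]) auto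
    then show ?thesis by auto
  qed
  moreover have "closed ((\<lambda>z. 1 / z) ` (E - {0}))"
    using assms(1) by (intro finite_imp_closed) auto
  ultimately show ?thesis using assms(2) by (simp add: image_inv_coord open_closed)
qed

lemma inv_coord_inj: "0 \<in> E \<Longrightarrow> inj_on inv_coord (- (Some ` E))"
proof (rule inj_onI)
  fix p q assume "0 \<in> E" "p \<in> - (Some ` E)" "q \<in> - (Some ` E)" "inv_coord p = inv_coord q"
  then show "p = q" by (cases p; cases q) auto
qed

lemma inv_point_inv_coord: "p \<noteq> Some 0 \<Longrightarrow> inv_point (inv_coord p) = p"
  by (cases p) (auto simp: inv_point_def)

lemma inv_coord_inv_point: "inv_coord (inv_point \<zeta>) = \<zeta>"
  by (auto simp: inv_point_def)

lemma continuous_map_inv_point: "continuous_map euclidean riemann_sphere inv_point"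
  unfolding continuous_map_def
proof (intro conjI allI impI)
  fix U assume "openin riemann_sphere U"
  then have U: "open (Some -` U)" "None \<in> U \<Longrightarrow> bounded (- (Some -` U))"
    by (auto simp: openin_riemann_sphere)
  have c: "continuous_on (- {0}) (\<lambda>\<zeta>::complex. 1 / \<zeta>)" by (auto intro!: continuous_intros)
  then have o: "open ((\<lambda>\<zeta>. 1 / \<zeta>) -` (Some -` U) \<inter> - {0})"
    using continuous_open_preimage[OF c _ U(1)] by (simp add: Int_commute open_Compl)
  show "openin euclidean {\<zeta> \<in> topspace euclidean. inv_point \<zeta> \<in> U}"
  proof (cases "None \<in> U")
    case False
    then have "{\<zeta> \<in> topspace euclidean. inv_point \<zeta> \<in> U} = (\<lambda>\<zeta>. 1 / \<zeta>) -` (Some -` U) \<inter> - {0}"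
      by (auto simp: inv_point_def split: if_splits)
    with o show ?thesis by simp
  next
    case True
    then obtain B where B: "B > 0" "\<And>z. z \<in> - (Some -` U) \<Longrightarrow> norm z \<le> B"
      using U(2)[OF True] unfolding bounded_pos by auto
    have near: "Some (1 / \<zeta>) \<in> U" if "norm \<zeta> < 1 / B" "\<zeta> \<noteq> 0" for \<zeta>
    proof (rule ccontr)
      assume c: "Some (1 / \<zeta>) \<notin> U"
      then have "norm (1 / \<zeta>) \<le> B" using B(2) by simp
      then have "1 / norm \<zeta> \<le> B" by (simp add: norm_divide)
      with that have "1 \<le> B * norm \<zeta>" by (simp add: pos_divide_le_eq)
      with that B(1) show False by (simp add: pos_less_divide_eq mult.commute)
    qed
    have "{\<zeta> \<in> topspace euclidean. inv_point \<zeta> \<in> U}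
        = ball 0 (1 / B) \<union> ((\<lambda>\<zeta>. 1 / \<zeta>) -` (Some -` U) \<inter> - {0})"
      using True B(1) by (auto simp: inv_point_def intro: near split: if_splits)
    with o show ?thesis by (auto intro: open_Un)
  qed
qed auto

lemma openin_finite_complement: "finite E \<Longrightarrow> openin riemann_sphere (- (Some ` E))"
proof -
  assume "finite E"
  moreover have "Some -` (- (Some ` E)) = - E" by auto
  ultimately show ?thesis
    by (simp add: openin_riemann_sphere finite_imp_closed open_Compl finite_imp_bounded)
qed

lemma continuous_map_inv_coord:
  assumes "finite E" "0 \<in> E"
  shows "continuous_map (subtopology riemann_sphere (- (Some ` E))) euclidean inv_coord"
  unfolding continuous_map_def
proof (intro conjI allI impI)
  fix W assume W: "openin euclidean (W :: complex set)"
  let ?V = "{p \<in> topspace (subtopology riemann_sphere (- (Some ` E))). inv_coord p \<in> W}"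
  have "open (- E)" using assms(1) by (simp add: finite_imp_closed open_Compl)
  moreover have "continuous_on (- E) (\<lambda>z. 1 / z)" using assms(2) by (auto intro!: continuous_intros)
  ultimately have o: "open ((\<lambda>z. 1 / z) -` W \<inter> - E)"
    using W continuous_open_preimage[of "- E" "\<lambda>z. 1 / z" W] by (simp add: Int_commute)
  have eq: "Some -` ?V = (\<lambda>z. 1 / z) -` W \<inter> - E" by auto
  have "bounded (- ((\<lambda>z. 1 / z) -` W \<inter> - E))" if "None \<in> ?V"
  proof -
    have "0 \<in> W" using that by simp
    then obtain e where e: "e > 0" "ball 0 e \<subseteq> W" using W open_contains_ball by force
    have "norm z \<le> 1 / e" if "1 / z \<notin> W" for z
    proof -
      have z: "e \<le> norm (1 / z)" using e(2) that by (metis dist_0_norm mem_ball not_le subsetD)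
      then have "z \<noteq> 0" using e(1) by auto
      with z e(1) show ?thesis by (simp add: norm_divide field_simps)
    qed
    then have "- ((\<lambda>z. 1 / z) -` W \<inter> - E) \<subseteq> cball 0 (1 / e) \<union> E" by auto
    then show ?thesis
      using assms(1) by (meson bounded_Un bounded_cball bounded_subset finite_imp_bounded)
  qed
  then have "openin riemann_sphere ?V"
    unfolding openin_riemann_sphere eq using o by blast
  then show "openin (subtopology riemann_sphere (- (Some ` E))) ?V"
    by (subst openin_open_subtopology) (auto simp: openin_finite_complement assms)
qed auto

lemma homeomorphic_map_inv_coord:
  assumes "finite E" "0 \<in> E"
  shows "homeomorphic_map (subtopology riemann_sphere (- (Some ` E)))
    (top_of_set (inv_coord ` (- (Some ` E)))) inv_coord"
proof -
  have "homeomorphic_maps (subtopology riemann_sphere (- (Some ` E)))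
      (top_of_set (inv_coord ` (- (Some ` E)))) inv_coord inv_point"
    unfolding homeomorphic_maps_def
  proof (intro conjI ballI)
    show "continuous_map (subtopology riemann_sphere (- (Some ` E)))
        (top_of_set (inv_coord ` (- (Some ` E)))) inv_coord"
      using continuous_map_inv_coord[OF assms] by (auto simp: continuous_map_in_subtopology)
    have "inv_point (inv_coord p) \<in> - (Some ` E)" if "p \<in> - (Some ` E)" for p
    proof -
      have "p \<noteq> Some 0" using that assms(2) by auto
      then show ?thesis using that by (simp add: inv_point_inv_coord)
    qed
    then show "continuous_map (top_of_set (inv_coord ` (- (Some ` E))))
        (subtopology riemann_sphere (- (Some ` E))) inv_point"
      using continuous_map_inv_point
      by (auto simp: continuous_map_in_subtopology intro: continuous_map_from_subtopology)
  qed (use assms(2) in \<open>auto simp: inv_coord_inv_point intro!: inv_point_inv_coord\<close>)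
  then show ?thesis using homeomorphic_map_maps by blast
qed

lemma homeomorphic_map_the:
  "homeomorphic_map (subtopology riemann_sphere (range Some)) euclidean the"
proof -
  have "homeomorphic_map euclidean (subtopology riemann_sphere (range Some)) Some"
    using embedding_map_Some[of "euclidean :: complex topology"]
    by (simp add: embedding_map_def riemann_sphere_def)
  then obtain g where g: "homeomorphic_maps euclidean (subtopology riemann_sphere (range Some)) Some g"
    using homeomorphic_map_maps by blast
  then have "homeomorphic_map (subtopology riemann_sphere (range Some)) euclidean g"
    by (simp add: homeomorphic_maps_map)
  moreover have "g p = the p" if "p \<in> topspace (subtopology riemann_sphere (range Some))" for p
    using g that by (auto simp: homeomorphic_maps_def)
  ultimately show ?thesis by (rule homeomorphic_map_eq)
qed

lemma finite_chart_simps [simp]: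
  "cdom finite_chart = range Some" "cmap finite_chart = the"
  by (simp_all add: finite_chart_def)

lemma infinity_chart_simps [simp]:
  "cdom (infinity_chart E) = - (Some ` E)" "cmap (infinity_chart E) = inv_coord"
  by (simp_all add: infinity_chart_def)

lemma cinv_finite_chart [simp]: "inv_into (range Some) the = Some"
proof
  fix z :: 'a show "inv_into (range Some) the z = Some z"
    by (intro inv_into_f_eq inj_onI) auto
qed

lemma cinv_infinity_chart:
  assumes "0 \<in> E" "\<zeta> \<in> inv_coord ` (- (Some ` E))"
  shows "inv_into (- (Some ` E)) inv_coord \<zeta> = inv_point \<zeta>"
  using inv_coord_inj[OF assms(1)]
proof (rule inv_into_f_eq)
  obtain p where p: "p \<in> - (Some ` E)" "\<zeta> = inv_coord p" using assms(2) by auto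
  then have "p \<noteq> Some 0" using assms(1) by auto
  with p show "inv_point \<zeta> \<in> - (Some ` E)" "inv_coord (inv_point \<zeta>) = \<zeta>"
    by (simp_all add: inv_coord_inv_point inv_point_inv_coord)
qed

lemma infinity_neq_finite_chart: "infinity_chart E \<noteq> finite_chart"
proof
  assume "infinity_chart E = finite_chart"
  then have "cdom (infinity_chart E) = cdom finite_chart" by simp
  moreover have "None \<in> cdom (infinity_chart E)" by auto
  ultimately show False by auto
qed

definition sphere_atlas :: "complex set \<Rightarrow> complex option chart set" where
  "sphere_atlas E = {finite_chart, infinity_chart E}"

lemma chart_overlap:
  assumes "0 \<in> E"
  shows "inv_coord ` (range Some \<inter> - (Some ` E)) = {\<zeta>. \<zeta> \<noteq> 0 \<and> 1 / \<zeta> \<notin> E}"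
proof (intro Set.set_eqI iffI)
  fix \<zeta> assume "\<zeta> \<in> {\<zeta>. \<zeta> \<noteq> 0 \<and> 1 / \<zeta> \<notin> E}"
  then have "\<zeta> = inv_coord (Some (1 / \<zeta>))" "Some (1 / \<zeta>) \<in> range Some \<inter> - (Some ` E)" by auto
  then show "\<zeta> \<in> inv_coord ` (range Some \<inter> - (Some ` E))" by blast
qed (use assms in auto)

lemma compact_riemann_surface_sphere:
  assumes "finite E" "0 \<in> E"
  shows "compact_riemann_surface riemann_sphere (sphere_atlas E)"
proof -
  have dom: "(\<Union>c\<in>sphere_atlas E. cdom c) = UNIV"
  proof -
    have "p \<in> range Some \<union> - (Some ` E)" for p :: "complex option" by (cases p) auto
    then show ?thesis by (auto simp: sphere_atlas_def)
  qed
  have fin: "openin riemann_sphere (range Some)"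
    by (simp add: openin_riemann_sphere) (metis UNIV_I open_UNIV subsetI subset_antisym vimageI2 rangeI)
  have surj: "the ` range Some = (UNIV :: complex set)" by force
  have charts: "\<forall>c\<in>sphere_atlas E. openin riemann_sphere (cdom c) \<and> open (cmap c ` cdom c) \<and>
      homeomorphic_map (subtopology riemann_sphere (cdom c)) (top_of_set (cmap c ` cdom c)) (cmap c)"
    using fin surj homeomorphic_map_the openin_finite_complement[OF assms(1)]
      open_image_inv_coord[OF assms] homeomorphic_map_inv_coord[OF assms]
    by (auto simp: sphere_atlas_def)
  have fi: "(inv_coord \<circ> Some) holomorphic_on the ` (range Some \<inter> - (Some ` E))"
  proof -
    have "(\<lambda>z. 1 / z) holomorphic_on the ` (range Some \<inter> - (Some ` E))"
      using assms(2) by (auto intro!: holomorphic_intros)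
    then show ?thesis by (simp add: o_def)
  qed
  have "(the \<circ> cinv (infinity_chart E)) holomorphic_on inv_coord ` (- (Some ` E) \<inter> range Some)"
  proof -
    have "(\<lambda>\<zeta>. 1 / \<zeta>) holomorphic_on {\<zeta>. \<zeta> \<noteq> 0 \<and> 1 / \<zeta> \<notin> E}"
      by (auto intro!: holomorphic_intros)
    then have "(the \<circ> cinv (infinity_chart E)) holomorphic_on {\<zeta>. \<zeta> \<noteq> 0 \<and> 1 / \<zeta> \<notin> E}"
      by (rule holomorphic_transform)
        (auto simp: cinv_infinity_chart[OF assms(2)] image_inv_coord[OF assms(2)] inv_point_def)
    then show ?thesis using chart_overlap[OF assms(2)] by (simp add: Int_commute)
  qed
  moreover have "(inv_coord \<circ> cinv (infinity_chart E)) holomorphic_on inv_coord ` (- (Some ` E))"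
    by (rule holomorphic_transform[of "\<lambda>\<zeta>. \<zeta>"])
      (auto simp: cinv_infinity_chart[OF assms(2)] inv_coord_inv_point intro!: holomorphic_intros)
  moreover have "(the \<circ> Some) holomorphic_on the ` range Some"
    by (simp add: o_def)
  ultimately have "\<forall>c\<in>sphere_atlas E. \<forall>d\<in>sphere_atlas E.
      (cmap d \<circ> cinv c) holomorphic_on cmap c ` (cdom c \<inter> cdom d)"
    using fi by (auto simp: sphere_atlas_def)
  with dom charts show ?thesis
    unfolding compact_riemann_surface_def
    by (simp add: compact_riemann_sphere Hausdorff_riemann_sphere connected_riemann_sphere)
qed

section \<open>Genus\<close>

text \<open>Inverse stereographic projection from the north pole, with values in the model
  \<open>nsphere 2\<close> of the sphere by sequences that vanish above index 2. It gives access to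
  the known homology of spheres.\<close>

fun stereographic :: "complex option \<Rightarrow> nat \<Rightarrow> real" where
  "stereographic None = (\<lambda>i. if i = 2 then 1 else 0)"
| "stereographic (Some z) = (\<lambda>i.
     if i = 0 then 2 * Re z / (1 + (norm z)\<^sup>2)
     else if i = 1 then 2 * Im z / (1 + (norm z)\<^sup>2)
     else if i = 2 then 1 - 2 / (1 + (norm z)\<^sup>2) else 0)"

lemma sum_atMost_2: "(\<Sum>i\<le>2. f i) = f 0 + f 1 + f (2::nat)" for f :: "nat \<Rightarrow> real"
  by (simp add: numeral_2_eq_2)

lemma topspace_nsphere_2:
  "x \<in> topspace (nsphere 2) \<longleftrightarrow> (x 0)\<^sup>2 + (x 1)\<^sup>2 + (x 2)\<^sup>2 = 1 \<and> (\<forall>i>2. x i = 0)"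
  unfolding nsphere by (simp add: sum_atMost_2)

lemma stereographic_in_nsphere: "stereographic p \<in> topspace (nsphere 2)"
proof (cases p)
  case (Some z)
  define d where "d = 1 + (norm z)\<^sup>2"
  have d: "d > 0" unfolding d_def by (simp add: add_pos_nonneg)
  have "(2 * Re z / d)\<^sup>2 + (2 * Im z / d)\<^sup>2 = 4 * (d - 1) / d\<^sup>2"
    unfolding d_def by (simp add: cmod_power2 power_divide power_mult_distrib add_divide_distrib[symmetric])
  moreover have "4 * (d - 1) / d\<^sup>2 + (1 - 2 / d)\<^sup>2 = 1"
    using d by (simp add: field_simps power2_eq_square)
  ultimately show ?thesis using Some unfolding topspace_nsphere_2 d_def by simp
qed (simp add: topspace_nsphere_2)

lemma continuous_map_stereographic: "continuous_map riemann_sphere (nsphere 2) stereographic"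
proof -
  have nz: "1 + (norm z)\<^sup>2 \<noteq> 0" for z :: complex
    by (metis add_pos_nonneg less_numeral_extra(3) zero_le_power2 zero_less_one)
  have cont: "continuous_on UNIV (\<lambda>z. stereographic (Some z) i)" for i
    by (cases "i = 0"; cases "i = 1"; cases "i = 2") (auto intro!: continuous_intros simp: nz)
  have ninf: "filterlim (norm :: complex \<Rightarrow> real) at_top at_infinity"
    by (rule filterlim_norm_at_top)
  have q: "((\<lambda>t::real. 2 / (1 + t\<^sup>2)) \<longlongrightarrow> 0) at_top" "((\<lambda>t::real. 2 * t / (1 + t\<^sup>2)) \<longlongrightarrow> 0) at_top"
    by real_asymp+
  note q' = filterlim_compose[OF q(1) ninf] filterlim_compose[OF q(2) ninf]
  have lim: "((\<lambda>z. stereographic (Some z) i) \<longlongrightarrow> stereographic None i) at_infinity" for i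
  proof -
    have re: "((\<lambda>z. 2 * Re z / (1 + (norm z)\<^sup>2)) \<longlongrightarrow> 0) at_infinity"
      by (rule Lim_null_comparison[OF _ q'(2)])
        (auto simp: abs_mult abs_Re_le_cmod add_nonneg_nonneg intro!: always_eventually divide_right_mono)
    have im: "((\<lambda>z. 2 * Im z / (1 + (norm z)\<^sup>2)) \<longlongrightarrow> 0) at_infinity"
      by (rule Lim_null_comparison[OF _ q'(2)])
        (auto simp: abs_mult abs_Im_le_cmod add_nonneg_nonneg intro!: always_eventually divide_right_mono)
    have "((\<lambda>z. 1 - 2 / (1 + (norm (z::complex))\<^sup>2)) \<longlongrightarrow> 1 - 0) at_infinity"
      by (intro tendsto_diff tendsto_const q')
    with re im show ?thesis by (cases "i = 0"; cases "i = 1"; cases "i = 2") auto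
  qed
  have "continuous_map riemann_sphere (powertop_real UNIV) stereographic"
    unfolding continuous_map_componentwise_UNIV
    by (intro allI continuous_map_riemann_sphere cont lim)
  then show ?thesis
    using stereographic_in_nsphere unfolding nsphere by (auto simp: continuous_map_in_subtopology)
qed

lemma bij_betw_stereographic: "bij_betw stereographic UNIV (topspace (nsphere 2))"
proof (rule bij_betw_byWitness[where f' = "\<lambda>x. if x 2 = 1 then None
    else Some (Complex (x 0 / (1 - x 2)) (x 1 / (1 - x 2)))"])
  have nz: "1 + (norm z)\<^sup>2 \<noteq> 0" for z :: complex
    by (metis add_pos_nonneg less_numeral_extra(3) zero_le_power2 zero_less_one)
  show "\<forall>p\<in>UNIV. (if stereographic p 2 = 1 then None
      else Some (Complex (stereographic p 0 / (1 - stereographic p 2))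
        (stereographic p 1 / (1 - stereographic p 2)))) = p"
  proof
    fix p show "(if stereographic p 2 = 1 then None
      else Some (Complex (stereographic p 0 / (1 - stereographic p 2))
        (stereographic p 1 / (1 - stereographic p 2)))) = p"
      using nz by (cases p) (auto simp: complex_eq_iff)
  qed
  show "\<forall>x\<in>topspace (nsphere 2). stereographic (if x 2 = 1 then None
      else Some (Complex (x 0 / (1 - x 2)) (x 1 / (1 - x 2)))) = x"
  proof
    fix x assume "x \<in> topspace (nsphere 2)"
    then have x: "(x 0)\<^sup>2 + (x 1)\<^sup>2 + (x 2)\<^sup>2 = 1" "\<And>i. i > 2 \<Longrightarrow> x i = 0"
      unfolding topspace_nsphere_2 by auto
    have idx: "i = 0 \<or> i = 1 \<or> i = 2 \<or> i > 2" for i :: nat by linarith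
    show "stereographic (if x 2 = 1 then None
      else Some (Complex (x 0 / (1 - x 2)) (x 1 / (1 - x 2)))) = x"
    proof (cases "x 2 = 1")
      case True
      then have "x 0 = 0" "x 1 = 0" using x(1) by (auto simp: sum_power2_eq_zero_iff)
      with True x(2) idx show ?thesis by (auto simp: fun_eq_iff) (metis idx)
    next
      case False
      define s where "s = 1 - x 2"
      have s: "s \<noteq> 0" using False by (simp add: s_def)
      have "1 + (norm (Complex (x 0 / s) (x 1 / s)))\<^sup>2 = 1 + ((x 0)\<^sup>2 + (x 1)\<^sup>2) / s\<^sup>2"
        by (simp add: cmod_power2 power_divide add_divide_distrib)
      \<comment> \<open>The sphere equation with \<open>s = 1 - x 2\<close>, as
        \<open>1 - (x 2)^2 = s * (2 - s)\<close>.\<close>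
      also have "(x 0)\<^sup>2 + (x 1)\<^sup>2 = s * (2 - s)"
        using x(1) by (simp add: s_def algebra_simps power2_eq_square)
      also have "1 + s * (2 - s) / s\<^sup>2 = 2 / s"
        using s by (simp add: field_simps power2_eq_square)
      finally have n: "1 + (norm (Complex (x 0 / s) (x 1 / s)))\<^sup>2 = 2 / s" .
      have "stereographic (Some (Complex (x 0 / s) (x 1 / s))) i = x i" for i
        using idx[of i] x(2) s unfolding stereographic.simps n by (auto simp: s_def field_simps)
      with False show ?thesis by (auto simp: s_def)
    qed
  qed
qed (use stereographic_in_nsphere in auto)

lemma isomorphic_trivial_groups:
  assumes "trivial_group G" "trivial_group H"
  shows "G \<cong> H"
proof -
  have "(\<lambda>x. \<one>\<^bsub>H\<^esub>) \<in> iso G H"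
    using assms by (auto simp: trivial_group_def iso_def hom_def bij_betw_def group.is_monoid monoid.l_one)
  then show ?thesis by (auto simp: is_iso_def)
qed

text \<open>A continuous bijection from a compact space to a Hausdorff space is a homeomorphism, so
  the first homology is that of the 2-sphere. It is trivial, as is the free abelian group on no
  generators.\<close>

lemma has_genus_riemann_sphere: "has_genus riemann_sphere 0"
proof -
  have "Hausdorff_space (nsphere 2)"
    unfolding nsphere_def by (intro Hausdorff_space_subtopology Hausdorff_Euclidean_space)
  then have "homeomorphic_map riemann_sphere (nsphere 2) stereographic"
    using bij_betw_stereographic
    by (intro continuous_imp_homeomorphic_map continuous_map_stereographic compact_riemann_sphere)
      (auto simp: bij_betw_def)
  then have "riemann_sphere homeomorphic_space nsphere 2"
    using homeomorphic_map_imp_homeomorphic_space by blast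
  then have "homology_group 1 riemann_sphere \<cong> homology_group 1 (nsphere 2)"
    by (rule homeomorphic_space_imp_isomorphic_homology_groups)
  moreover have "trivial_group (homology_group 1 (nsphere 2))"
    using reduced_homology_group_nsphere(2)[of 1 2] by (simp add: un_reduced_homology_group)
  ultimately have "trivial_group (homology_group 1 riemann_sphere)"
    using isomorphic_group_triviality[of "homology_group 1 riemann_sphere" "homology_group 1 (nsphere 2)"]
    by simp
  moreover have "trivial_group (free_Abelian_group ({} :: nat set))"
    unfolding trivial_group_def by (rule conjI, simp, simp add: free_Abelian_group_def)
  ultimately show ?thesis
    unfolding has_genus_def by (simp add: isomorphic_trivial_groups)
qed

section \<open>Periods\<close>

definition ends :: "nat \<Rightarrow> complex option set" where
  "ends m = insert None (Some ` (- regular m))"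

text \<open>For the coordinate \<open>\<zeta> = 1 / z\<close> one has
  \<open>dz = - z^2 d\<zeta>\<close>, which gives the second coefficient. At \<open>None\<close> it
  has an unspecified value, which is harmless because \<open>None\<close> is an end.\<close>

definition form :: "nat \<Rightarrow> 3 \<Rightarrow> complex option one_form" where
  "form m i = (\<lambda>c p. if c = finite_chart then phi m i (the p)
     else - phi m i (the p) * (the p)\<^sup>2)"

definition omega :: "nat \<Rightarrow> complex option one_form ^ 3" where
  "omega m = (\<chi> i. form m i)"

lemma omega_nth [simp]: "omega m $ i = form m i"
  by (simp add: omega_def)

lemma finite_compl_regular: "finite (- regular m)"
  by (simp add: regular_def)

lemma zero_notin_regular [simp]: "0 \<notin> regular m"
  by (simp add: regular_def)

lemma open_regular: "open (regular m)"
  using finite_imp_closed[OF finite_compl_regular[of m]] by (simp add: open_closed)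

lemma connected_regular: "connected (regular m)"
  using connected_open_delete_finite[of "UNIV :: complex set" "- regular m"]
  by (simp add: finite_compl_regular Compl_eq_Diff_UNIV[symmetric] connected_UNIV)

lemma compl_ends: "- ends m = Some ` regular m"
proof (intro Set.set_eqI)
  fix p show "p \<in> - ends m \<longleftrightarrow> p \<in> Some ` regular m"
    by (cases p) (auto simp: ends_def)
qed

abbreviation atlas :: "nat \<Rightarrow> complex option chart set" where
  "atlas m \<equiv> sphere_atlas (- regular m)"

lemma chart_at_Some: "chart_at (atlas m) (Some z) \<in> atlas m \<and> Some z \<in> cdom (chart_at (atlas m) (Some z))"
  unfolding chart_at_def
  by (rule someI[of _ finite_chart]) (auto simp: sphere_atlas_def)

lemma continuous_the_path:
  assumes "pathin riemann_sphere \<gamma>" "\<And>t. t \<in> {0..1} \<Longrightarrow> \<gamma> t \<in> range Some"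
  shows "continuous_on {0..1} (the \<circ> \<gamma>)"
proof -
  have "pathin (subtopology riemann_sphere (range Some)) \<gamma>"
    using assms by (simp add: pathin_subtopology)
  moreover have "continuous_map (subtopology riemann_sphere (range Some)) euclidean the"
    using homeomorphic_map_the homeomorphic_imp_continuous_map by blast
  ultimately have "pathin euclidean (the \<circ> \<gamma>)" by (rule pathin_compose)
  then show ?thesis by (simp add: pathin_def)
qed

text \<open>Near \<open>t\<close> a continuous logarithm \<open>L\<close> of \<open>g\<close>
  coincides with \<open>Ln (g s / g t) + L t\<close>, namely as long as the imaginary part of
  \<open>L s - L t\<close> stays between \<open>- pi\<close> and \<open>pi\<close>; and
  \<open>Ln\<close> is differentiable at \<open>1\<close>.\<close>

lemma has_vector_derivative_continuous_logarithm:
  fixes g L :: "real \<Rightarrow> complex"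
  assumes "open U" "t \<in> U" "continuous_on U L" "\<And>s. s \<in> U \<Longrightarrow> g s = exp (L s)"
    and "(g has_vector_derivative D) (at t)"
  shows "(L has_vector_derivative 1 / g t * D) (at t)"
proof -
  have gt: "g t \<noteq> 0" using assms(2,4) by simp
  have "((\<lambda>w. Ln (w / g t)) has_field_derivative 1 / g t) (at (g t))"
    using gt by (auto intro!: derivative_eq_intros)
  from field_vector_diff_chain_at[OF assms(5) this]
  have "((\<lambda>s. Ln (g s / g t)) has_vector_derivative D * (1 / g t)) (at t)"
    by (simp add: o_def)
  then have der: "((\<lambda>s. Ln (g s / g t) + L t) has_vector_derivative 1 / g t * D) (at t)"
    by (auto intro!: derivative_eq_intros)
  define V where "V = {s \<in> U. Im (L s - L t) \<in> {- pi<..<pi}}"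
  have "continuous_on U (\<lambda>s. Im (L s - L t))" by (intro continuous_intros assms)
  from continuous_open_preimage[OF this assms(1) open_greaterThanLessThan]
  have "open V" by (simp add: V_def vimage_def Int_def)
  moreover have "t \<in> V" using assms(2) by (simp add: V_def)
  moreover have "Ln (g s / g t) + L t = L s" if "s \<in> V" for s
  proof -
    have "g s / g t = exp (L s - L t)" using that assms(2,4) by (simp add: V_def exp_diff)
    then show ?thesis using that by (simp add: V_def Ln_exp)
  qed
  ultimately show ?thesis using has_vector_derivative_transform_within_open[OF der] by blast
qed

text \<open>The first two forms have single-valued rational primitives. The third has none on the
  punctured plane, but along a curve a continuous logarithm exists because the parameter interval is
  contractible, and its real part \<open>ln (norm (g t))\<close> depends on the point only.\<close>

lemma phi_primitive_along_curve:
  assumes "continuous_on {0..1} g" "\<And>t. t \<in> {0..1} \<Longrightarrow> g t \<in> regular m"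
    and "\<And>t. t \<in> {0<..<1} - T \<Longrightarrow> (g has_vector_derivative D t) (at t)"
  obtains F where "continuous_on {0..1} F"
    "\<And>t. t \<in> {0<..<1} - T \<Longrightarrow> (F has_vector_derivative phi m i (g t) * D t) (at t)"
    "Re (F 1 - F 0) = surf m (g 1) $ i - surf m (g 0) $ i"
proof -
  have hcont: "continuous_on (regular m) (hpart m)" "continuous_on (regular m) (kpart m)"
    by (meson DERIV_isCont continuous_at_imp_continuous_on hpart_has_field_derivative kpart_has_field_derivative)+
  have sub: "g ` {0..1} \<subseteq> regular m" using assms(2) by auto
  consider "i = 1" | "i = 2" | "i = 3" using exhaust_3 by blast
  then show thesis
  proof cases
    case 1
    define F where "F = (\<lambda>z. hpart m z + kpart m z) \<circ> g"
    show thesis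
    proof (rule that)
      show "continuous_on {0..1} F" unfolding F_def
        by (intro continuous_on_compose assms continuous_on_subset[OF _ sub] continuous_intros hcont)
      fix t assume t: "t \<in> {0<..<1} - T"
      then have "g t \<in> regular m" using assms(2) by auto
      then have "((\<lambda>z. hpart m z + kpart m z) has_field_derivative hder m (g t) + kder m (g t)) (at (g t))"
        by (auto intro!: derivative_eq_intros)
      from field_vector_diff_chain_at[OF assms(3)[OF t] this]
      show "(F has_vector_derivative phi m i (g t) * D t) (at t)"
        using 1 by (simp add: F_def phi_def mult.commute)
    qed (use 1 in \<open>simp add: F_def surf_def\<close>)
  next
    case 2
    define F where "F = (\<lambda>z. - \<i> * (hpart m z - kpart m z)) \<circ> g"
    show thesis
    proof (rule that)
      show "continuous_on {0..1} F" unfolding F_def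
        by (intro continuous_on_compose assms continuous_on_subset[OF _ sub] continuous_intros hcont)
      fix t assume t: "t \<in> {0<..<1} - T"
      then have "g t \<in> regular m" using assms(2) by auto
      then have "((\<lambda>z. - \<i> * (hpart m z - kpart m z)) has_field_derivative
          - \<i> * (hder m (g t) - kder m (g t))) (at (g t))"
        by (auto intro!: derivative_eq_intros)
      from field_vector_diff_chain_at[OF assms(3)[OF t] this]
      show "(F has_vector_derivative phi m i (g t) * D t) (at t)"
        using 2 by (simp add: F_def phi_def mult.commute)
    qed (use 2 in \<open>simp add: F_def surf_def\<close>)
  next
    case 3
    have nz: "g t \<noteq> 0" if "t \<in> {0..1}" for t using assms(2)[OF that] regularD by auto
    obtain L where L: "continuous_on {0..1} L" "\<And>t. t \<in> {0..1} \<Longrightarrow> g t = exp (L t)"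
      using continuous_logarithm_on_contractible[OF assms(1) _ nz]
        convex_imp_contractible[of "{0..1::real}"] by auto
    show thesis
    proof (rule that)
      fix t assume t: "t \<in> {0<..<1} - T"
      have "(L has_vector_derivative 1 / g t * D t) (at t)"
        by (rule has_vector_derivative_continuous_logarithm[of "{0<..<1}"])
          (use t L assms(3) in \<open>auto intro: continuous_on_subset\<close>)
      then show "(L has_vector_derivative phi m i (g t) * D t) (at t)"
        using 3 by (simp add: phi_def)
    next
      have "g 0 = exp (L 0)" "g 1 = exp (L 1)" using L(2) by auto
      then show "Re (L 1 - L 0) = surf m (g 1) $ i - surf m (g 0) $ i"
        using 3 by (simp add: surf_def)
    qed (rule L)
  qed
qed

text \<open>This settles two matters at once: real periods over closed curves vanish, and the
  harmonic map is \<open>surf m\<close> up to a translation, whichever curve is chosen.\<close>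

lemma Re_form_integral:
  assumes "curve_in riemann_sphere (atlas m) (- ends m) \<gamma>"
  shows "Re (form_integral (atlas m) (form m i) \<gamma>)
    = surf m (the (\<gamma> 1)) $ i - surf m (the (\<gamma> 0)) $ i"
proof -
  define g where "g = the \<circ> \<gamma>"
  from assms obtain T where path: "pathin riemann_sphere \<gamma>"
    and S: "\<And>t. t \<in> {0..1} \<Longrightarrow> \<gamma> t \<in> - ends m" and T: "finite T"
    and C1: "(cmap finite_chart \<circ> \<gamma>) C1_differentiable_on {t \<in> {0..1} - T. \<gamma> t \<in> cdom finite_chart}"
    by (auto simp: curve_in_def pathin_subtopology sphere_atlas_def simp del: finite_chart_simps)
  have g: "\<gamma> t = Some (g t)" "g t \<in> regular m" if "t \<in> {0..1}" for t
    using S[OF that] unfolding compl_ends g_def by auto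
  have cont: "continuous_on {0..1} g"
    unfolding g_def using path g(1) by (intro continuous_the_path) auto
  from C1 obtain D where D0: "\<forall>t\<in>{t \<in> {0..1} - T. \<gamma> t \<in> cdom finite_chart}.
      (cmap finite_chart \<circ> \<gamma> has_vector_derivative D t) (at t)"
    unfolding C1_differentiable_on_def by blast
  have D: "(g has_vector_derivative D t) (at t)" if "t \<in> {0..1} - T" for t
    using D0 that g(1)[of t] by (auto simp: g_def)
  obtain F where F: "continuous_on {0..1} F"
    "\<And>t. t \<in> {0<..<1} - T \<Longrightarrow> (F has_vector_derivative phi m i (g t) * D t) (at t)"
    "Re (F 1 - F 0) = surf m (g 1) $ i - surf m (g 0) $ i"
    by (rule phi_primitive_along_curve[OF cont g(2), of T D i]) (use D in auto)
  have int: "((\<lambda>t. phi m i (g t) * D t) has_integral F 1 - F 0) {0..1}"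
    by (rule fundamental_theorem_of_calculus_interior_strong[OF T _ F(2,1)]) auto
  have "form_integral (atlas m) (form m i) \<gamma> = F 1 - F 0"
    unfolding form_integral_def
  proof (rule integral_unique, rule has_integral_spike_finite[OF _ _ int])
    \<comment> \<open>The endpoints are discarded with \<open>T\<close>:
      \<open>vector_derivative\<close> at an endpoint would also see values of
      \<open>\<gamma>\<close> outside the unit interval, about which nothing is known.\<close>
    show "finite (insert 0 (insert 1 T))" using T by simp
    fix t assume t: "t \<in> {0..1} - insert 0 (insert 1 T)"
    then have ti: "t \<in> {0<..<1}" by auto
    have Dt: "(g has_vector_derivative D t) (at t)" using D t by auto
    have gt: "\<gamma> t = Some (g t)" "g t \<in> regular m" using g t by auto
    then have nz: "g t \<noteq> 0" using regularD by auto
    show "(let c = chart_at (atlas m) (\<gamma> t)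
        in form m i c (\<gamma> t) * vector_derivative (cmap c \<circ> \<gamma>) (at t)) = phi m i (g t) * D t"
    proof (cases "chart_at (atlas m) (\<gamma> t) = finite_chart")
      case True
      then show ?thesis using vector_derivative_at[OF Dt]
        by (simp add: form_def g_def[symmetric]) (simp add: g_def)
    next
      case False
      then have c: "chart_at (atlas m) (\<gamma> t) = infinity_chart (- regular m)"
        using chart_at_Some[of m "g t"] gt(1) by (auto simp: sphere_atlas_def)
      have "((\<lambda>z. 1 / z) has_field_derivative - 1 / (g t)\<^sup>2) (at (g t))"
        using nz by (auto intro!: derivative_eq_intros simp: power2_eq_square)
      from field_vector_diff_chain_at[OF Dt this]
      have "((\<lambda>s. 1 / g s) has_vector_derivative D t * (- 1 / (g t)\<^sup>2)) (at t)"
        by (simp add: o_def)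
      then have "((inv_coord \<circ> \<gamma>) has_vector_derivative D t * (- 1 / (g t)\<^sup>2)) (at t)"
        by (rule has_vector_derivative_transform_within_open[OF _ open_greaterThanLessThan ti])
          (use g(1) in auto)
      from vector_derivative_at[OF this] show ?thesis
        unfolding Let_def c using nz gt(1) by (simp add: form_def infinity_neq_finite_chart)
    qed
  qed
  with F(3) show ?thesis by (simp add: g_def)
qed

text \<open>Needed for the choice in \<open>harmonic_map\<close> to pick an actual curve. The
  complement of finitely many points in the plane is open and connected, so a polynomial path
  exists; it is smooth in both charts.\<close>

lemma curve_exists:
  assumes "z \<in> regular m" "w \<in> regular m"
  obtains \<gamma> where "curve_in riemann_sphere (atlas m) (- ends m) \<gamma>" "\<gamma> 0 = Some z" "\<gamma> 1 = Some w"
proof -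
  obtain p where p: "polynomial_function p" "path_image p \<subseteq> regular m" "pathstart p = z" "pathfinish p = w"
    using connected_open_polynomial_connected[OF open_regular connected_regular assms] by blast
  obtain p' where p': "polynomial_function p'" "\<And>t. (p has_vector_derivative p' t) (at t)"
    using has_vector_derivative_polynomial_function[OF p(1)] by blast
  have reg: "p t \<in> regular m" if "t \<in> {0..1}" for t using p(2) that by (auto simp: path_image_def)
  have contp: "continuous_on S p" "continuous_on S p'" for S
    using p(1) p'(1) continuous_on_polymonial_function by auto
  have "pathin (subtopology riemann_sphere (- ends m)) (Some \<circ> p)"
  proof -
    have "pathin euclidean p" using contp by (simp add: pathin_def)
    then have "pathin riemann_sphere (Some \<circ> p)"
      unfolding riemann_sphere_def by (rule pathin_compose[OF _ continuous_map_Some])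
    then show ?thesis using reg by (simp add: pathin_subtopology compl_ends)
  qed
  moreover have "p C1_differentiable_on A" for A
    unfolding C1_differentiable_on_def using p'(2) contp by blast
  moreover have "(\<lambda>t. 1 / p t) C1_differentiable_on {t \<in> {0..1}. p t \<in> regular m}"
    unfolding C1_differentiable_on_def
  proof (intro exI conjI ballI)
    fix t assume "t \<in> {t \<in> {0..1}. p t \<in> regular m}"
    then have nz: "p t \<noteq> 0" using regularD by auto
    then have "((\<lambda>z. 1 / z) has_field_derivative - 1 / (p t)\<^sup>2) (at (p t))"
      by (auto intro!: derivative_eq_intros simp: power2_eq_square)
    from field_vector_diff_chain_at[OF p'(2) this]
    show "((\<lambda>t. 1 / p t) has_vector_derivative p' t * (- 1 / (p t)\<^sup>2)) (at t)"
      by (simp add: o_def)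
  next
    show "continuous_on {t \<in> {0..1}. p t \<in> regular m} (\<lambda>t. p' t * (- 1 / (p t)\<^sup>2))"
      using regularD by (auto intro!: continuous_intros contp)
  qed
  ultimately have "curve_in riemann_sphere (atlas m) (- ends m) (Some \<circ> p)"
    unfolding curve_in_def
    by (intro conjI exI[of _ "{}"]) (auto simp: sphere_atlas_def o_def image_iff cong: conj_cong)
  moreover have "(Some \<circ> p) 0 = Some z" "(Some \<circ> p) 1 = Some w"
    using p(3,4) by (auto simp: pathstart_def pathfinish_def)
  ultimately show thesis using that by blast
qed

lemma harmonic_map_eq:
  assumes "z0 \<in> regular m" "z \<in> regular m"
  shows "harmonic_map riemann_sphere (atlas m) (ends m) (omega m) (Some z0) (Some z) = surf m z - surf m z0"
proof -
  define \<gamma> where "\<gamma> = (SOME \<gamma>. curve_in riemann_sphere (atlas m) (topspace riemann_sphere - ends m) \<gamma>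
    \<and> \<gamma> 0 = Some z0 \<and> \<gamma> 1 = Some z)"
  obtain \<delta> where "curve_in riemann_sphere (atlas m) (- ends m) \<delta>" "\<delta> 0 = Some z0" "\<delta> 1 = Some z"
    using curve_exists[OF assms] by blast
  then have "curve_in riemann_sphere (atlas m) (topspace riemann_sphere - ends m) \<gamma>
      \<and> \<gamma> 0 = Some z0 \<and> \<gamma> 1 = Some z"
    unfolding \<gamma>_def by - (rule someI[of _ \<delta>], simp add: Compl_eq_Diff_UNIV[symmetric])
  then show ?thesis
    unfolding harmonic_map_def \<gamma>_def[symmetric] Let_def
    by (simp add: vec_eq_iff Re_form_integral Compl_eq_Diff_UNIV[symmetric])
qed

section \<open>Types of ends\<close>

text \<open>At most a double pole, with \<open>A\<close> the coefficient of
  \<open>(w - z)^-2\<close>. Since \<open>A = 0\<close> is allowed, the notion is closed under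
  linear combinations and \<open>A\<close> depends linearly on \<open>g\<close>; the order is
  exactly two once \<open>A \<noteq> 0\<close>.\<close>

definition double_pole :: "(complex \<Rightarrow> complex) \<Rightarrow> complex \<Rightarrow> complex \<Rightarrow> bool" where
  "double_pole g z A \<longleftrightarrow> (\<exists>S u. open S \<and> z \<in> S \<and> u holomorphic_on S \<and> u z = A \<and>
     (\<forall>w\<in>S - {z}. g w = u w / (w - z)\<^sup>2))"

lemma double_poleI:
  assumes "open S" "z \<in> S" "u holomorphic_on S" "u z = A"
    and "\<And>w. w \<in> S \<Longrightarrow> w \<noteq> z \<Longrightarrow> g w = u w / (w - z)\<^sup>2"
  shows "double_pole g z A"
  using assms unfolding double_pole_def by blast

lemma double_pole_add:
  assumes "double_pole g z A" "double_pole h z B"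
  shows "double_pole (\<lambda>w. g w + h w) z (A + B)"
proof -
  obtain S u where u: "open S" "z \<in> S" "u holomorphic_on S" "u z = A"
    "\<forall>w\<in>S - {z}. g w = u w / (w - z)\<^sup>2" using assms(1) unfolding double_pole_def by blast
  obtain T v where v: "open T" "z \<in> T" "v holomorphic_on T" "v z = B"
    "\<forall>w\<in>T - {z}. h w = v w / (w - z)\<^sup>2" using assms(2) unfolding double_pole_def by blast
  show ?thesis
    by (rule double_poleI[of "S \<inter> T" _ "\<lambda>w. u w + v w"])
      (use u v in \<open>auto intro!: holomorphic_intros simp: add_divide_distrib elim: holomorphic_on_subset\<close>)
qed

lemma double_pole_cmult:
  assumes "double_pole g z A"
  shows "double_pole (\<lambda>w. c * g w) z (c * A)"
proof -
  obtain S u where u: "open S" "z \<in> S" "u holomorphic_on S" "u z = A"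
    "\<forall>w\<in>S - {z}. g w = u w / (w - z)\<^sup>2" using assms unfolding double_pole_def by blast
  show ?thesis
    by (rule double_poleI[of S _ "\<lambda>w. c * u w"]) (use u in \<open>auto intro!: holomorphic_intros\<close>)
qed

lemma double_pole_holomorphic:
  assumes "open S" "z \<in> S" "g holomorphic_on S"
  shows "double_pole g z 0"
  by (rule double_poleI[of S _ "\<lambda>w. g w * (w - z)\<^sup>2"]) (use assms in \<open>auto intro!: holomorphic_intros\<close>)

lemma double_pole_sum:
  assumes "\<And>j. j \<in> I \<Longrightarrow> double_pole (g j) z (A j)"
  shows "double_pole (\<lambda>w. \<Sum>j\<in>I. g j w) z (\<Sum>j\<in>I. A j)"
  using assms
proof (induction I rule: infinite_finite_induct)
  case (insert j I)
  then show ?case by (simp add: double_pole_add)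
qed (auto intro: double_pole_holomorphic[of UNIV])

lemma double_pole_cong:
  assumes "\<And>w. w \<in> U \<Longrightarrow> w \<noteq> z \<Longrightarrow> g w = h w" "open U" "z \<in> U" "double_pole g z A"
  shows "double_pole h z A"
proof -
  obtain S u where u: "open S" "z \<in> S" "u holomorphic_on S" "u z = A"
    "\<forall>w\<in>S - {z}. g w = u w / (w - z)\<^sup>2" using assms(4) unfolding double_pole_def by blast
  show ?thesis
  proof (rule double_poleI[of "S \<inter> U" _ u])
    fix w assume "w \<in> S \<inter> U" "w \<noteq> z"
    then show "h w = u w / (w - z)\<^sup>2" using u(5) assms(1)[of w] by auto
  qed (use u assms in \<open>auto elim: holomorphic_on_subset\<close>)
qed

lemma double_pole_tendsto:
  assumes "double_pole g z A"
  shows "((\<lambda>w. (w - z)\<^sup>2 * g w) \<longlongrightarrow> A) (at z)"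
proof -
  obtain S u where u: "open S" "z \<in> S" "u holomorphic_on S" "u z = A"
    "\<forall>w\<in>S - {z}. g w = u w / (w - z)\<^sup>2" using assms unfolding double_pole_def by blast
  have "isCont u z"
    using u by (meson continuous_on_eq_continuous_at holomorphic_on_imp_continuous_on)
  then have "(u \<longlongrightarrow> A) (at z)" using u(4) by (simp add: isCont_def)
  moreover have "\<forall>\<^sub>F w in at z. u w = (w - z)\<^sup>2 * g w"
    unfolding eventually_at_topological using u by (intro exI[of _ S]) auto
  ultimately show ?thesis by (simp add: tendsto_cong)
qed

section \<open>Orders of poles and reduced form\<close>

definition order_of_pole :: "(complex \<Rightarrow> complex) \<Rightarrow> complex \<Rightarrow> nat" where
  "order_of_pole g z = (if is_pole g z then nat (- zorder g z) else 0)"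

lemma order_of_poleI:
  assumes "open S" "z \<in> S" "u holomorphic_on S" "u z \<noteq> 0" "n > 0"
    and "\<And>w. w \<in> S \<Longrightarrow> w \<noteq> z \<Longrightarrow> g w = u w / (w - z) ^ n"
  shows "order_of_pole g z = n"
proof -
  have "zorder g z = - int n"
    by (rule zorder_eqI[OF assms(1-4)]) (use assms(6) in \<open>simp add: power_int_minus divide_inverse\<close>)
  moreover have "is_pole g z"
  proof -
    have "isCont u z"
      using assms by (meson continuous_on_eq_continuous_at holomorphic_on_imp_continuous_on)
    then have "is_pole (\<lambda>w. u w / (w - z) ^ n) z"
      using assms(4,5) by (intro is_pole_divide) (auto intro!: filterlim_at_withinI tendsto_eq_intros
          simp: eventually_at_filter)
    then show ?thesis
      using assms(1,2,6)
      by (subst is_pole_cong[where g = "\<lambda>w. u w / (w - z) ^ n" and b = z])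
        (auto simp: eventually_at_topological)
  qed
  ultimately show ?thesis by (simp add: order_of_pole_def)
qed

lemma order_of_pole_double_pole:
  assumes "double_pole g z A" "A \<noteq> 0"
  shows "order_of_pole g z = 2"
  using assms unfolding double_pole_def by (auto intro!: order_of_poleI)

lemma order_of_pole_holomorphic:
  assumes "open S" "z \<in> S" "g holomorphic_on S"
  shows "order_of_pole g z = 0"
proof -
  have "\<not> is_pole g z"
    using assms by (meson holomorphic_on_imp_continuous_on continuous_on_eq_continuous_at
        isCont_def not_tendsto_and_filterlim_at_infinity is_pole_def trivial_limit_at)
  then show ?thesis by (simp add: order_of_pole_def)
qed

lemma pole_order_eq:
  "chart_at \<A> p = c \<Longrightarrow> pole_order \<A> w p = order_of_pole (coeff_fun w c) (cmap c p)"
  by (simp add: pole_order_def order_of_pole_def Let_def)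

lemma linear_act_linear_act: "linear_act M (linear_act N \<omega>) = linear_act (M ** N) \<omega>"
  by (simp add: linear_act_def vec_eq_iff fun_eq_iff matrix_matrix_mult_def sum_3 algebra_simps)

text \<open>A real combination of the three forms has a double pole unless it is a multiple of the
  third one, and by invertibility at most one row of the matrix is such a multiple.\<close>

lemma end_has_type_double_pole:
  fixes \<omega> :: "'a one_form ^ 3" and A :: "3 \<Rightarrow> complex"
  assumes c: "chart_at \<A> p = c" and z: "cmap c p = z"
    and dp: "\<And>i. double_pole (coeff_fun (\<omega> $ i) c) z (A i)" and A3: "A 3 = 0"
    and indep: "Im (A 1 * cnj (A 2)) \<noteq> 0"
    and d: "\<And>a :: real. a \<noteq> 0 \<Longrightarrow> order_of_pole (\<lambda>w. of_real a * coeff_fun (\<omega> $ 3) c w) z = d" "d < 2"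
  shows "end_has_type \<A> \<omega> p (d, 2, 2)"
proof -
  have coeff: "coeff_fun (linear_act M \<omega> $ i) c = (\<lambda>w. \<Sum>j\<in>UNIV. of_real (M $ i $ j) * coeff_fun (\<omega> $ j) c w)"
    for M :: "real ^ 3 ^ 3" and i by (simp add: linear_act_def coeff_fun_def fun_eq_iff)
  have two: "pole_order \<A> (linear_act M \<omega> $ i) p = 2" if "M $ i $ 1 \<noteq> 0 \<or> M $ i $ 2 \<noteq> 0" for M :: "real ^ 3 ^ 3" and i
  proof -
    have "double_pole (coeff_fun (linear_act M \<omega> $ i) c) z (\<Sum>j\<in>UNIV. of_real (M $ i $ j) * A j)"
      unfolding coeff by (intro double_pole_sum double_pole_cmult dp)
    moreover have "(\<Sum>j\<in>UNIV. of_real (M $ i $ j) * A j) \<noteq> 0"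
    proof
      assume "(\<Sum>j\<in>UNIV. of_real (M $ i $ j) * A j) = 0"
      then have e: "of_real (M $ i $ 1) * A 1 + of_real (M $ i $ 2) * A 2 = 0"
        by (simp add: sum_3 A3)
      \<comment> \<open>Multiplying the real relation between \<open>A 1\<close> and
        \<open>A 2\<close> by \<open>cnj (A 2)\<close> or \<open>cnj (A 1)\<close> and taking
        imaginary parts isolates one coefficient each time.\<close>
      have "M $ i $ 1 * Im (A 1 * cnj (A 2)) = Im ((of_real (M $ i $ 1) * A 1 + of_real (M $ i $ 2) * A 2) * cnj (A 2))"
        by (simp add: algebra_simps)
      moreover have "- (M $ i $ 2 * Im (A 1 * cnj (A 2))) = Im ((of_real (M $ i $ 1) * A 1 + of_real (M $ i $ 2) * A 2) * cnj (A 1))"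
        by (simp add: algebra_simps)
      ultimately show False using that indep unfolding e by auto
    qed
    ultimately show ?thesis
      by (simp add: pole_order_eq[OF c] z order_of_pole_double_pole)
  qed
  have low: "pole_order \<A> (linear_act M \<omega> $ i) p = d"
    if "M $ i $ 1 = 0" "M $ i $ 2 = 0" "M $ i $ 3 \<noteq> 0" for M :: "real ^ 3 ^ 3" and i
    using d(1)[OF that(3)] that(1,2) by (simp add: pole_order_eq[OF c] z coeff sum_3)
  \<comment> \<open>A cyclic permutation of the coordinates that puts the height form, the one of
    low order, first.\<close>
  define M0 :: "real ^ 3 ^ 3" where
    "M0 = vector [vector [0, 0, 1], vector [1, 0, 0], vector [0, 1, 0]]"
  have inv: "invertible M0" by (simp add: M0_def invertible_det_nz det_3)
  have orders: "pole_orders \<A> (linear_act M0 \<omega>) p = (d, 2, 2)"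
    unfolding pole_orders_def by (simp add: M0_def two low)
  have "(pole_orders \<A> (linear_act M (linear_act M0 \<omega>)) p, (d, 2, 2)) \<notin> lex3" if "invertible M" for M
  proof -
    define N where "N = M ** M0"
    have "invertible N" unfolding N_def using that inv by (rule invertible_mult)
    then have det: "det N \<noteq> 0" by (simp add: invertible_det_nz)
    define V where "V = (\<lambda>i. N $ i $ 1 = 0 \<and> N $ i $ 2 = 0)"
    \<comment> \<open>Only the first row matters. If it is no multiple of the height form, the first
      order is \<open>2 > d\<close>, so the triple is larger; if it is one, the other rows are not,
      and the triple is \<open>(d, 2, 2)\<close> again.\<close>
    have "\<not> (V 1 \<and> V 2)" "\<not> (V 1 \<and> V 3)"
      using det by (auto simp: V_def det_3)
    moreover have "pole_order \<A> (linear_act N \<omega> $ i) p = (if V i then d else 2)" for i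
    proof (cases "V i")
      case True
      have "N $ i $ 3 \<noteq> 0"
      proof
        assume "N $ i $ 3 = 0"
        with True have "row i N = 0"
          by (auto simp: V_def row_def vec_eq_iff) (metis exhaust_3)
        with det det_zero_row(1) show False by blast
      qed
      with True low show ?thesis by (simp add: V_def)
    qed (auto simp: V_def two)
    ultimately show ?thesis
      unfolding linear_act_linear_act N_def[symmetric] using d(2)
      by (auto simp: pole_orders_def lex3_def)
  qed
  moreover have "pole_order \<A> (linear_act M0 \<omega> $ 1) p = d" "pole_order \<A> (linear_act M0 \<omega> $ 2) p = 2"
    "pole_order \<A> (linear_act M0 \<omega> $ 3) p = 2"
    using orders by (simp_all add: pole_orders_def)
  ultimately have "reduced_end \<A> (linear_act M0 \<omega>) p"
    unfolding reduced_end_def orders using d(2) by simp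
  with inv orders show ?thesis unfolding end_has_type_def by blast
qed

section \<open>Principal parts at the ends\<close>

lemma pole_inj: "pole i = pole j \<longleftrightarrow> i = j"
  by (simp add: pole_def)

lemma double_pole_quot_finite:
  assumes "J < m" "j \<le> m" "z0 = (if J = 0 then 0 else of_real (pole J))"
  shows "double_pole (\<lambda>z. quot m j z z) z0 (if j = J then of_real (pole J) else 0)"
proof -
  consider "j = 0" | "j \<noteq> 0" "j = m" | "1 \<le> j" "j < m" using assms(2) by linarith
  then show ?thesis
  proof cases
    case 1
    show ?thesis
    proof (cases "J = 0")
      case True
      with 1 assms show ?thesis
        by (intro double_poleI[of UNIV _ "\<lambda>z. 1"]) (auto simp: quot_def pole_def power2_eq_square)
    next
      case False
      with 1 assms show ?thesis
        by (auto intro!: double_pole_holomorphic[of "- {0}"] holomorphic_intros simp: quot_def)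
    qed
  next
    case 2
    with assms show ?thesis
      by (auto intro!: double_pole_holomorphic[of UNIV] simp: quot_def)
  next
    case 3
    show ?thesis
    proof (cases "j = J")
      case True
      with 3 assms show ?thesis
        by (intro double_poleI[of UNIV _ "\<lambda>z. of_real (pole J)"]) (auto simp: quot_def power2_eq_square)
    next
      case False
      with 3 assms have "z0 \<noteq> of_real (pole j)" by (auto simp: pole_inj)
      moreover have "(\<lambda>z. quot m j z z) holomorphic_on - {of_real (pole j)}"
        using 3 by (auto intro!: holomorphic_intros simp: quot_def)
      ultimately show ?thesis using False
        by (auto intro!: double_pole_holomorphic[of "- {of_real (pole j)}"])
    qed
  qed
qed

text \<open>The factor \<open>- (1 / \<zeta>)^2\<close> comes from the change of coordinate. Every
  quotient with \<open>j < m\<close> decays like \<open>\<zeta>^2\<close>, which cancels it; the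
  constant quotient with \<open>j = m\<close> leaves a double pole.\<close>

lemma double_pole_quot_infinity:
  assumes "m > 0" "j \<le> m"
  shows "double_pole (\<lambda>\<zeta>. - quot m j (1 / \<zeta>) (1 / \<zeta>) * (1 / \<zeta>)\<^sup>2) 0 (if j = m then - of_real (1 / pole m) else 0)"
proof -
  consider "j = 0" | "j \<noteq> 0" "j = m" | "1 \<le> j" "j < m" using assms(2) by linarith
  then show ?thesis
  proof cases
    case 1
    then have "- quot m j (1 / \<zeta>) (1 / \<zeta>) * (1 / \<zeta>)\<^sup>2 = - 1" if "\<zeta> \<noteq> 0" for \<zeta>
      using that by (simp add: quot_def power2_eq_square)
    moreover have "double_pole (\<lambda>\<zeta>. - 1) 0 0" by (rule double_pole_holomorphic[of UNIV]) auto
    ultimately show ?thesis using double_pole_cong[of UNIV 0 "\<lambda>\<zeta>. - 1"] 1 assms(1) by auto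
  next
    case 2
    then show ?thesis
      by (intro double_poleI[of UNIV _ "\<lambda>z. - of_real (1 / pole m)"])
        (auto simp: quot_def power_divide)
  next
    case 3
    define p where "p = complex_of_real (pole j)"
    have p: "p \<noteq> 0" by (simp add: p_def)
    have "- p / (1 - p * \<zeta>)\<^sup>2 = - quot m j (1 / \<zeta>) (1 / \<zeta>) * (1 / \<zeta>)\<^sup>2"
      if "\<zeta> \<noteq> 0" "\<zeta> \<noteq> 1 / p" for \<zeta>
    proof -
      have "1 / \<zeta> - p = (1 - p * \<zeta>) / \<zeta>" using that by (simp add: field_simps)
      then have "quot m j (1 / \<zeta>) (1 / \<zeta>) = p / ((1 - p * \<zeta>) / \<zeta>)\<^sup>2"
        using 3 unfolding quot_def p_def[symmetric] by (simp add: power2_eq_square)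
      then show ?thesis using that by (simp add: power_divide)
    qed
    moreover have "double_pole (\<lambda>\<zeta>. - p / (1 - p * \<zeta>)\<^sup>2) 0 0"
    proof (rule double_pole_holomorphic[of "- {1 / p}"])
      have "1 - p * \<zeta> \<noteq> 0" if "\<zeta> \<noteq> 1 / p" for \<zeta> using that p by (auto simp: field_simps)
      then show "(\<lambda>\<zeta>. - p / (1 - p * \<zeta>)\<^sup>2) holomorphic_on - {1 / p}"
        by (intro holomorphic_intros) auto
    qed (use p in auto)
    ultimately have "double_pole (\<lambda>\<zeta>. - quot m j (1 / \<zeta>) (1 / \<zeta>) * (1 / \<zeta>)\<^sup>2) 0 0"
      using p by - (rule double_pole_cong[of "- {1 / p}" 0 "\<lambda>\<zeta>. - p / (1 - p * \<zeta>)\<^sup>2"], auto)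
    with 3 show ?thesis by simp
  qed
qed

text \<open>Leading coefficients of the three forms at end \<open>J\<close>, where \<open>v\<close>
  is the contribution of its own term. The second is \<open>\<i> * v\<close> for either parity, the
  first changes sign; hence the limiting normal points up at odd ends and down at even ones.\<close>

definition end_coeff :: "nat \<Rightarrow> complex \<Rightarrow> 3 \<Rightarrow> complex" where
  "end_coeff J v i = (if i = 1 then (if odd J then - v else v) else if i = 2 then \<i> * v else 0)"

lemma double_pole_phi:
  assumes h: "double_pole H z (if odd J then - v else 0)"
    and k: "double_pole K z (if even J then v else 0)" and "double_pole L z 0"
  shows "double_pole (\<lambda>w. if i = 1 then H w + K w else if i = (2::3) then - \<i> * (H w - K w) else L w) z
    (end_coeff J v i)"
proof -
  consider "i = 1" | "i = 2" | "i = 3" using exhaust_3 by blast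
  then show ?thesis
  proof cases
    case 1
    then show ?thesis using double_pole_add[OF h k] by (simp add: end_coeff_def split: if_splits)
  next
    case 2
    then show ?thesis
      using double_pole_cmult[OF double_pole_add[OF h double_pole_cmult[OF k, of "-1"]], of "- \<i>"]
      by (simp add: end_coeff_def split: if_splits)
  qed (use assms in \<open>auto simp: end_coeff_def\<close>)
qed

lemma double_pole_phi_finite:
  assumes "J < m" "z0 = (if J = 0 then 0 else of_real (pole J))"
  shows "double_pole (phi m i) z0 (end_coeff J (of_real (pole J)) i)"
proof -
  let ?v = "complex_of_real (pole J)"
  have "double_pole (\<lambda>z. \<Sum>j | j \<le> m \<and> odd j. quot m j z z) z0 (\<Sum>j | j \<le> m \<and> odd j. if j = J then ?v else 0)"
    by (rule double_pole_sum) (use double_pole_quot_finite assms in auto)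
  from double_pole_cmult[OF this, of "-1"]
  have h: "double_pole (hder m) z0 (if odd J then - ?v else 0)"
    using assms(1) by (auto simp: hder_def[abs_def] split: if_splits)
  have "double_pole (\<lambda>z. \<Sum>j | j \<le> m \<and> even j. quot m j z z) z0 (\<Sum>j | j \<le> m \<and> even j. if j = J then ?v else 0)"
    by (rule double_pole_sum) (use double_pole_quot_finite assms in auto)
  then have k: "double_pole (kder m) z0 (if even J then ?v else 0)"
    using assms(1) by (auto simp: kder_def[abs_def] split: if_splits)
  have l: "double_pole (\<lambda>z. 1 / z) z0 0"
  proof (cases "J = 0")
    case True
    then show ?thesis using assms(2)
      by (intro double_poleI[of UNIV _ "\<lambda>z. z"]) (auto simp: power2_eq_square)
  next
    case False
    then show ?thesis using assms(2)
      by (intro double_pole_holomorphic[of "- {0}"]) (auto intro!: holomorphic_intros)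
  qed
  show ?thesis using double_pole_phi[OF h k l, of i] by (simp add: phi_def[abs_def])
qed

lemma double_pole_phi_infinity:
  assumes "m > 0"
  shows "double_pole (\<lambda>\<zeta>. - phi m i (1 / \<zeta>) * (1 / \<zeta>)\<^sup>2) 0 (end_coeff m (- of_real (1 / pole m)) i)"
proof -
  let ?v = "- complex_of_real (1 / pole m)"
  have "double_pole (\<lambda>\<zeta>. \<Sum>j | j \<le> m \<and> odd j. - quot m j (1 / \<zeta>) (1 / \<zeta>) * (1 / \<zeta>)\<^sup>2) 0
      (\<Sum>j | j \<le> m \<and> odd j. if j = m then ?v else 0)"
    by (rule double_pole_sum) (use double_pole_quot_infinity assms in auto)
  from double_pole_cmult[OF this, of "-1"]
  have h: "double_pole (\<lambda>\<zeta>. - hder m (1 / \<zeta>) * (1 / \<zeta>)\<^sup>2) 0 (if odd m then - ?v else 0)"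
    by (auto simp: hder_def[abs_def] sum_distrib_right sum_negf split: if_splits)
  have "double_pole (\<lambda>\<zeta>. \<Sum>j | j \<le> m \<and> even j. - quot m j (1 / \<zeta>) (1 / \<zeta>) * (1 / \<zeta>)\<^sup>2) 0
      (\<Sum>j | j \<le> m \<and> even j. if j = m then ?v else 0)"
    by (rule double_pole_sum) (use double_pole_quot_infinity assms in auto)
  then have k: "double_pole (\<lambda>\<zeta>. - kder m (1 / \<zeta>) * (1 / \<zeta>)\<^sup>2) 0 (if even m then ?v else 0)"
    by (auto simp: kder_def[abs_def] sum_distrib_right sum_negf split: if_splits)
  have l: "double_pole (\<lambda>\<zeta>. - (1 / (1 / \<zeta>)) * (1 / \<zeta>)\<^sup>2) 0 0"
    by (rule double_poleI[of UNIV _ "\<lambda>z. 0 - z"]) (auto intro!: holomorphic_intros simp: power2_eq_square)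
  show ?thesis using double_pole_phi[OF h k l, of i]
    by (rule double_pole_cong[rotated -1, of _ _ _ UNIV]) (auto simp: phi_def algebra_simps)
qed

section \<open>The one-forms are meromorphic\<close>

lemma quot_holomorphic: "j \<le> m \<Longrightarrow> (\<lambda>z. quot m j z z) holomorphic_on regular m"
proof -
  assume "j \<le> m"
  then consider "j = 0" | "j \<noteq> 0" "j = m" | "1 \<le> j" "j < m" by linarith
  then show ?thesis
  proof cases
    case 3
    then have "z - of_real (pole j) \<noteq> 0" if "z \<in> regular m" for z
      using regularD(2)[OF that] by auto
    with 3 show ?thesis by (auto simp: quot_def intro!: holomorphic_intros)
  qed (auto simp: quot_def intro!: holomorphic_intros dest: regularD)
qed

lemma phi_holomorphic: "phi m i holomorphic_on regular m"
proof -
  have "hder m holomorphic_on regular m" "kder m holomorphic_on regular m"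
    unfolding hder_def[abs_def] kder_def[abs_def]
    by (auto intro!: holomorphic_intros quot_holomorphic)
  moreover have "(\<lambda>z. 1 / z) holomorphic_on regular m"
    by (auto intro!: holomorphic_intros dest: regularD)
  ultimately show ?thesis
    unfolding phi_def[abs_def] by (cases "i = 1"; cases "i = 2") (auto intro!: holomorphic_intros)
qed

text \<open>The inner function serves both charts: it is \<open>z\<close> in the finite one and
  \<open>1 / \<zeta>\<close> at infinity.\<close>

lemma phi_meromorphic:
  assumes "f meromorphic_on S"
  shows "(\<lambda>z. phi m i (f z)) meromorphic_on S"
proof -
  have q: "(\<lambda>z. quot m j (f z) (f z)) meromorphic_on S" for j
    using assms unfolding quot_def
    by (cases "j = 0"; cases "j = m") (auto intro!: meromorphic_intros)
  have "(\<lambda>z. hder m (f z)) meromorphic_on S" "(\<lambda>z. kder m (f z)) meromorphic_on S"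
    unfolding hder_def kder_def by (intro meromorphic_intros q)+
  with assms show ?thesis
    unfolding phi_def by (cases "i = 1"; cases "i = 2") (auto intro!: meromorphic_intros)
qed

lemma form_finite: "form m i finite_chart (Some z) = phi m i z"
  by (simp add: form_def)

lemma form_infinity: "form m i (infinity_chart E) (Some z) = - phi m i z * z\<^sup>2"
  by (simp add: form_def infinity_neq_finite_chart)

lemma coeff_fun_finite: "coeff_fun (form m i) finite_chart = phi m i"
  by (simp add: coeff_fun_def form_finite)

lemma coeff_fun_infinity:
  assumes "\<zeta> \<in> inv_coord ` (- (Some ` (- regular m)))" "\<zeta> \<noteq> 0"
  shows "coeff_fun (form m i) (infinity_chart (- regular m)) \<zeta> = - phi m i (1 / \<zeta>) * (1 / \<zeta>)\<^sup>2"
  using assms by (simp add: coeff_fun_def cinv_infinity_chart inv_point_def form_infinity)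

lemma infinity_overlap_image:
  "inv_coord ` (- (Some ` (- regular m)) - ends m) = {\<zeta>. \<zeta> \<noteq> 0 \<and> 1 / \<zeta> \<in> regular m}"
proof -
  have "- (Some ` (- regular m)) - ends m = range Some \<inter> - (Some ` (- regular m))"
  proof (intro Set.set_eqI)
    fix p show "p \<in> - (Some ` (- regular m)) - ends m \<longleftrightarrow> p \<in> range Some \<inter> - (Some ` (- regular m))"
      by (cases p) (auto simp: ends_def)
  qed
  then show ?thesis by (simp add: chart_overlap)
qed

lemma deriv_inverse: "z \<noteq> 0 \<Longrightarrow> deriv (\<lambda>z::complex. 1 / z) z = - 1 / z\<^sup>2"
  by (intro DERIV_imp_deriv) (auto intro!: derivative_eq_intros simp: power2_eq_square)

lemma open_infinity_image: "open (inv_coord ` (- (Some ` (- regular m))))"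
  by (rule open_image_inv_coord) (auto simp: finite_compl_regular)

lemma meromorphic_form: "meromorphic_one_form riemann_sphere (atlas m) (ends m) (form m i)"
proof -
  let ?D = "- (Some ` (- regular m))" and ?I = "infinity_chart (- regular m)"
  have mero_inf: "coeff_fun (form m i) ?I meromorphic_on inv_coord ` ?D"
  proof -
    have mero: "(\<lambda>\<zeta>. - phi m i (1 / \<zeta>) * (1 / \<zeta>)\<^sup>2) meromorphic_on inv_coord ` ?D"
      by (intro meromorphic_intros phi_meromorphic)
    \<comment> \<open>The formula may fail at \<open>\<zeta> = 0\<close>, where the coefficient is
      unspecified, but being meromorphic only depends on punctured neighbourhoods.\<close>
    have ev: "\<forall>\<^sub>F \<zeta> in at \<zeta>0. - phi m i (1 / \<zeta>) * (1 / \<zeta>)\<^sup>2 = coeff_fun (form m i) ?I \<zeta>"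
      if "\<zeta>0 \<in> inv_coord ` ?D" for \<zeta>0
    proof -
      have "\<forall>\<^sub>F \<zeta> in at \<zeta>0. \<zeta> \<in> inv_coord ` ?D"
        using open_infinity_image that by (intro eventually_at_in_open') auto
      moreover have "\<forall>\<^sub>F \<zeta> in at \<zeta>0. \<zeta> \<noteq> 0"
        by (cases "\<zeta>0 = 0") (auto intro: eventually_neq_at_within)
      ultimately show ?thesis by eventually_elim (simp add: coeff_fun_infinity)
    qed
    show ?thesis by (rule iffD1[OF meromorphic_on_cong[OF ev refl] mero])
  qed
  have hol_inf: "coeff_fun (form m i) ?I holomorphic_on inv_coord ` (?D - ends m)"
  proof -
    have "(phi m i \<circ> (\<lambda>\<zeta>. 1 / \<zeta>)) holomorphic_on {\<zeta>. \<zeta> \<noteq> 0 \<and> 1 / \<zeta> \<in> regular m}"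
      by (rule holomorphic_on_compose_gen[OF _ phi_holomorphic]) (auto intro!: holomorphic_intros)
    then have "(\<lambda>\<zeta>. - phi m i (1 / \<zeta>) * (1 / \<zeta>)\<^sup>2) holomorphic_on {\<zeta>. \<zeta> \<noteq> 0 \<and> 1 / \<zeta> \<in> regular m}"
      by (auto intro!: holomorphic_intros simp: o_def)
    then show ?thesis unfolding infinity_overlap_image
      by (rule holomorphic_transform) (simp add: coeff_fun_infinity image_inv_coord)
  qed
  have fin_image: "the ` (range Some - ends m) = regular m"
  proof -
    have "range Some - ends m = Some ` regular m" unfolding compl_ends[symmetric] by (auto simp: ends_def)
    then show ?thesis by (simp add: image_image)
  qed
  have trans: "form m i c p = form m i d p * deriv (cmap d \<circ> cinv c) (cmap c p)"
    if "c \<in> atlas m" "d \<in> atlas m" and p: "p \<in> cdom c \<inter> cdom d - ends m" for c d p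
  proof -
    have "p \<in> Some ` regular m" using p compl_ends by blast
    then obtain z where z: "p = Some z" "z \<in> regular m" by auto
    have nz: "z \<noteq> 0" using z regularD by auto
    have near: "\<forall>\<^sub>F \<zeta> in nhds (1 / z). \<zeta> \<noteq> 0 \<and> \<zeta> \<in> inv_coord ` ?D"
    proof -
      have "open (inv_coord ` ?D \<inter> - {0})" using open_infinity_image by (intro open_Int) auto
      moreover have "1 / z \<in> inv_coord ` ?D \<inter> - {0}" using nz z by (auto simp: image_inv_coord)
      ultimately have "\<forall>\<^sub>F \<zeta> in nhds (1 / z). \<zeta> \<in> inv_coord ` ?D \<inter> - {0}"
        by (rule eventually_nhds_in_open)
      then show ?thesis by eventually_elim auto
    qed
    have ii: "deriv (inv_coord \<circ> inv_into ?D inv_coord) (1 / z) = 1"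
    proof -
      have "deriv (inv_coord \<circ> inv_into ?D inv_coord) (1 / z) = deriv (\<lambda>\<zeta>. \<zeta>) (1 / z)"
        by (rule deriv_cong_ev[OF eventually_mono[OF near]])
          (auto simp: cinv_infinity_chart inv_coord_inv_point)
      then show ?thesis by simp
    qed
    have "if": "deriv (the \<circ> inv_into ?D inv_coord) (1 / z) = - z\<^sup>2"
    proof -
      have "deriv (the \<circ> inv_into ?D inv_coord) (1 / z) = deriv (\<lambda>\<zeta>. 1 / \<zeta>) (1 / z)"
        by (rule deriv_cong_ev[OF eventually_mono[OF near]])
          (auto simp: cinv_infinity_chart inv_point_def)
      then show ?thesis using nz by (simp add: deriv_inverse power_divide)
    qed
    have fi: "deriv (inv_coord \<circ> Some) z = - 1 / z\<^sup>2"
      using deriv_inverse[OF nz] by (simp add: o_def)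
    have ff: "deriv (the \<circ> Some) z = (1::complex)" by (simp add: o_def)
    show ?thesis
      using that(1,2) nz z(1) ii "if" fi ff
      by (auto simp: sphere_atlas_def form_finite form_infinity)
  qed
  show ?thesis
    unfolding meromorphic_one_form_def
  proof (intro conjI ballI)
    fix c assume "c \<in> atlas m"
    then consider "c = finite_chart" | "c = ?I" by (auto simp: sphere_atlas_def)
    note cases = this
    show "coeff_fun (form m i) c meromorphic_on cmap c ` cdom c"
      using cases mero_inf
    proof cases
      case 1
      then show ?thesis using phi_meromorphic[of "\<lambda>z. z" UNIV m i]
        by (auto simp: coeff_fun_finite intro: meromorphic_intros meromorphic_on_subset)
    qed simp
    show "coeff_fun (form m i) c holomorphic_on cmap c ` (cdom c - ends m)"
      using cases hol_inf phi_holomorphic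
      by cases (auto simp: coeff_fun_finite fin_image)
  qed (rule trans)
qed

lemma harmonic_surface_omega:
  "harmonic_surface riemann_sphere (atlas m) (ends m) (omega m)"
  unfolding harmonic_surface_def
  using compact_riemann_surface_sphere[OF finite_compl_regular, of m] finite_compl_regular[of m]
  by (auto simp: ends_def[symmetric] meromorphic_form Re_form_integral Compl_eq_Diff_UNIV[symmetric])
     (simp add: ends_def)

section \<open>Embeddedness\<close>

lemma embedded:
  assumes "z0 \<in> regular m"
  shows "embedded_on (atlas m) (topspace riemann_sphere - ends m)
    (harmonic_map riemann_sphere (atlas m) (ends m) (omega m) (Some z0))"
proof -
  define f where "f = harmonic_map riemann_sphere (atlas m) (ends m) (omega m) (Some z0)"
  have f: "f (Some z) = surf m z - surf m z0" if "z \<in> regular m" for z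
    unfolding f_def by (rule harmonic_map_eq[OF assms that])
  have dom: "topspace riemann_sphere - ends m = Some ` regular m"
    using compl_ends by (simp add: Compl_eq_Diff_UNIV)
  have "inj_on f (Some ` regular m)"
    using surf_inj[of m] by (auto simp: inj_on_def f)
  moreover have "\<exists>D. ((f \<circ> cinv c) has_derivative D) (at (cmap c p)) \<and> inj D"
    if c: "c \<in> atlas m" and p: "p \<in> cdom c \<inter> Some ` regular m" for c p
  proof -
    obtain z where z: "p = Some z" "z \<in> regular m" using p by auto
    have nz: "z \<noteq> 0" using z regularD by auto
    define D where "D = (\<lambda>v. \<chi> i. Re (phi m i z * v))"
    have D: "(surf m has_derivative D) (at z)" "inj D"
      unfolding D_def using surf_has_derivative surf_derivative_inj z by auto
    have shift: "((\<lambda>z. surf m z - surf m z0) has_derivative D) (at z)"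
      using has_derivative_diff[OF D(1) has_derivative_const[of "surf m z0"]] by simp
    consider "c = finite_chart" | "c = infinity_chart (- regular m)"
      using c by (auto simp: sphere_atlas_def)
    then show ?thesis
    proof cases
      case 1
      have "((f \<circ> Some) has_derivative D) (at z)"
        by (rule has_derivative_transform_within_open[OF shift open_regular z(2)]) (simp add: f)
      with 1 z D(2) show ?thesis by auto
    next
      case 2
      \<comment> \<open>In the chart at infinity the derivative is preceded by multiplication by
        \<open>- z^2\<close>, which is bijective, so injectivity persists.\<close>
      have inv: "((\<lambda>\<zeta>. 1 / \<zeta>) has_derivative (\<lambda>v. - z\<^sup>2 * v)) (at (1 / z))"
        using nz unfolding has_field_derivative_def[symmetric]
        by (auto intro!: derivative_eq_intros simp: power2_eq_square)
      from nz have "((\<lambda>z. surf m z - surf m z0) has_derivative D) (at (1 / (1 / z)))"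
        using shift by simp
      from has_derivative_compose[OF inv this]
      have comp: "((\<lambda>\<zeta>. surf m (1 / \<zeta>) - surf m z0) has_derivative (\<lambda>v. D (- z\<^sup>2 * v))) (at (1 / z))" .
      let ?U = "inv_coord ` (- (Some ` (- regular m))) \<inter> - {0}"
      have "((f \<circ> cinv c) has_derivative (\<lambda>v. D (- z\<^sup>2 * v))) (at (1 / z))"
      proof (rule has_derivative_transform_within_open[OF comp])
        show "open ?U" using open_infinity_image by (intro open_Int) auto
        show "1 / z \<in> ?U" using nz z by (auto simp: image_inv_coord)
        fix \<zeta> assume "\<zeta> \<in> ?U"
        then show "surf m (1 / \<zeta>) - surf m z0 = (f \<circ> cinv c) \<zeta>"
          using 2 by (auto simp: cinv_infinity_chart inv_point_def f image_inv_coord)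
      qed
      moreover have "inj (\<lambda>v. D (- z\<^sup>2 * v))"
      proof (rule injI)
        fix x y assume "D (- z\<^sup>2 * x) = D (- z\<^sup>2 * y)"
        then have "- z\<^sup>2 * x = - z\<^sup>2 * y" by (rule injD[OF D(2)])
        then show "x = y" using nz by simp
      qed
      ultimately show ?thesis using 2 z by auto
    qed
  qed
  ultimately show ?thesis
    unfolding embedded_on_def immersion_on_def dom f_def[symmetric] by blast
qed

section \<open>Behaviour at the ends\<close>

text \<open>A chart is continuous and injective, so punctured neighbourhoods of \<open>p\<close> go
  into punctured neighbourhoods of its coordinate. This carries limits in the plane over to limits
  at the ends.\<close>

lemma filterlim_coordinate_atin:
  assumes "homeomorphic_map (subtopology X U) (top_of_set (f ` U)) f" "openin X U" "p \<in> U"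
    "open (f ` U)"
  shows "filterlim f (at (f p)) (atin X p)"
  unfolding filterlim_iff
proof (intro allI impI)
  fix P assume "eventually P (at (f p))"
  then obtain W where W: "open W" "f p \<in> W" "\<And>x. x \<in> W \<Longrightarrow> x \<noteq> f p \<Longrightarrow> P x"
    unfolding eventually_at_topological by blast
  have U: "U \<subseteq> topspace X" using assms(2) openin_subset by blast
  have "continuous_map (subtopology X U) (top_of_set (f ` U)) f"
    using assms(1) homeomorphic_imp_continuous_map by blast
  then have "openin (subtopology X U) {x \<in> topspace (subtopology X U). f x \<in> f ` U \<inter> W}"
    by (rule openin_continuous_map_preimage) (auto intro: openin_open_Int W)
  moreover have "{x \<in> topspace (subtopology X U). f x \<in> f ` U \<inter> W} = {x \<in> U. f x \<in> W}"
    using U by auto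
  ultimately have "openin X {x \<in> U. f x \<in> W}"
    using assms(2) openin_trans_full by fastforce
  moreover have "inj_on f U"
    using homeomorphic_imp_injective_map[OF assms(1)] U by (simp add: inf.absorb2)
  ultimately show "eventually (\<lambda>x. P (f x)) (atin X p)"
    unfolding eventually_atin using W assms(3)
    by (intro disjI2 exI[of _ "{x \<in> U. f x \<in> W}"]) (auto dest: inj_onD)
qed

lemma filterlim_the: "filterlim the (at z) (atin riemann_sphere (Some z))"
proof -
  have surj: "the ` range Some = (UNIV :: complex set)" by force
  have "openin riemann_sphere (range Some)"
    using compact_riemann_surface_sphere[of "{0}"]
    by (auto simp: compact_riemann_surface_def sphere_atlas_def)
  then have "filterlim the (at (the (Some z))) (atin riemann_sphere (Some z))"
    by (intro filterlim_coordinate_atin[where U = "range Some"])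
      (auto simp: homeomorphic_map_the surj)
  then show ?thesis by simp
qed

lemma filterlim_inv_coord: "filterlim inv_coord (at 0) (atin riemann_sphere None)"
  using filterlim_coordinate_atin[OF homeomorphic_map_inv_coord[of "{0}"] openin_finite_complement[of "{0}"]]
    open_image_inv_coord[of "{0}"] by force

lemma eventually_regular_atin:
  "\<forall>\<^sub>F p in atin riemann_sphere q. p \<in> Some ` regular m"
proof -
  have "finite (ends m - {q})" by (simp add: ends_def finite_compl_regular)
  then have "closedin riemann_sphere (ends m - {q})"
    by (intro closedin_Hausdorff_finite Hausdorff_riemann_sphere) auto
  then have "openin riemann_sphere (- (ends m - {q}))"
    by (simp add: closedin_def Compl_eq_Diff_UNIV)
  then show ?thesis
    unfolding eventually_atin compl_ends[symmetric]
    by (intro disjI2 exI[of _ "- (ends m - {q})"]) auto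
qed

section \<open>Limiting normals\<close>

definition normal_vec :: "(3 \<Rightarrow> complex) \<Rightarrow> real ^ 3" where
  "normal_vec w = vector [Im (w 2 * cnj (w 3)), Im (w 3 * cnj (w 1)), Im (w 1 * cnj (w 2))]"

text \<open>Each entry of the vector has the form \<open>Im (a * cnj b)\<close>, so a common complex
  factor \<open>s\<close> enters as \<open>s * cnj s\<close>, a nonnegative real. Hence neither a
  change of chart nor the removal of the double pole affects the normal.\<close>

lemma normal_scale: "normal_vec (\<lambda>i. s * w i) = (norm s)\<^sup>2 *\<^sub>R normal_vec w"
proof -
  have "Im (s * a * cnj (s * b)) = (norm s)\<^sup>2 * Im (a * cnj b)" for a b
  proof -
    have "s * a * cnj (s * b) = of_real ((norm s)\<^sup>2) * (a * cnj b)"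
      using complex_norm_square[of s] by (simp add: algebra_simps)
    then show ?thesis by (simp only: scaleR_conv_of_real[symmetric] scaleR_complex.sel)
  qed
  then show ?thesis by (simp add: normal_vec_def vec_eq_iff forall_3)
qed

lemma sgn_normal_scale: "s \<noteq> 0 \<Longrightarrow> sgn (normal_vec (\<lambda>i. s * w i)) = sgn (normal_vec w)"
  by (simp add: normal_scale sgn_scaleR)

lemma gauss_map_eq:
  assumes "z \<in> regular m"
  shows "gauss_map (atlas m) (omega m) (Some z) = sgn (normal_vec (\<lambda>i. phi m i z))"
proof -
  have nz: "z \<noteq> 0" using assms regularD by auto
  define c where "c = chart_at (atlas m) (Some z)"
  have "gauss_map (atlas m) (omega m) (Some z) = sgn (normal_vec (\<lambda>i. form m i c (Some z)))"
    by (simp add: gauss_map_def normal_vec_def c_def Let_def)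
  also have "\<dots> = sgn (normal_vec (\<lambda>i. phi m i z))"
  proof (cases "c = finite_chart")
    case False
    then have "c = infinity_chart (- regular m)"
      using chart_at_Some[of m z] by (auto simp: c_def sphere_atlas_def)
    then have eq: "(\<lambda>i. form m i c (Some z)) = (\<lambda>i. - z\<^sup>2 * phi m i z)"
      by (simp add: form_infinity mult.commute)
    show ?thesis unfolding eq by (rule sgn_normal_scale) (use nz in simp)
  qed (simp add: form_finite)
  finally show ?thesis .
qed

text \<open>\<open>A 3 = 0\<close> annihilates the two horizontal components in the limit, and the
  vertical one tends to a nonzero real number whose sign selects the alternative.\<close>

lemma tendsto_sgn_normal:
  assumes "\<And>i. ((\<lambda>x. u x i) \<longlongrightarrow> A i) F" "A 3 = 0" "Im (A 1 * cnj (A 2)) \<noteq> 0"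
  shows "((\<lambda>x. sgn (normal_vec (u x))) \<longlongrightarrow> vector [0, 0, 1]) F
    \<or> ((\<lambda>x. sgn (normal_vec (u x))) \<longlongrightarrow> vector [0, 0, - 1]) F"
proof -
  define t where "t = Im (A 1 * cnj (A 2))"
  define e :: "real ^ 3" where "e = vector [0, 0, 1]"
  have lim: "((\<lambda>x. normal_vec (u x)) \<longlongrightarrow> normal_vec A) F"
    unfolding normal_vec_def
  proof (rule vec_tendstoI)
    fix i :: 3
    consider "i = 1" | "i = 2" | "i = 3" using exhaust_3 by blast
    then show "((\<lambda>x. vector [Im (u x 2 * cnj (u x 3)), Im (u x 3 * cnj (u x 1)), Im (u x 1 * cnj (u x 2))] $ i)
        \<longlongrightarrow> vector [Im (A 2 * cnj (A 3)), Im (A 3 * cnj (A 1)), Im (A 1 * cnj (A 2))] $ i) F"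
      by cases (simp_all only: vector_3, auto intro!: tendsto_intros assms(1))
  qed
  have nA: "normal_vec A = t *\<^sub>R e"
    by (simp add: normal_vec_def t_def e_def assms(2) vec_eq_iff forall_3)
  have t: "t \<noteq> 0" using assms(3) by (simp add: t_def)
  have e: "norm e = 1" by (simp add: e_def norm_vec_def L2_set_def sum_3)
  then have "e \<noteq> 0" by auto
  with t have "normal_vec A \<noteq> 0" by (simp add: nA)
  from tendsto_sgn[OF lim this]
  have "((\<lambda>x. sgn (normal_vec (u x))) \<longlongrightarrow> sgn t *\<^sub>R e) F"
    unfolding nA using e by (simp add: sgn_scaleR sgn_div_norm[of e])
  moreover have "- e = vector [0, 0, - 1]" by (simp add: e_def vec_eq_iff forall_3)
  moreover have "sgn t = 1 \<or> sgn t = - 1" using t by (simp add: sgn_if)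
  ultimately show ?thesis by (auto simp: e_def)
qed

lemma end_coeff_independent:
  "v \<noteq> 0 \<Longrightarrow> Im v = 0 \<Longrightarrow> Im (end_coeff J v 1 * cnj (end_coeff J v 2)) \<noteq> 0"
  by (auto simp: end_coeff_def complex_eq_iff)

lemma end_coeff_3 [simp]: "end_coeff J v 3 = 0"
  by (simp add: end_coeff_def)

lemma vertical_limiting_normal_finite:
  assumes "J < m" "z0 = (if J = 0 then 0 else of_real (pole J))"
  shows "vertical_limiting_normal riemann_sphere (atlas m) (omega m) (Some z0)"
proof -
  let ?A = "end_coeff J (of_real (pole J))"
  define u where "u = (\<lambda>p i. (the p - z0)\<^sup>2 * phi m i (the p))"
  have "((\<lambda>p. u p i) \<longlongrightarrow> ?A i) (atin riemann_sphere (Some z0))" for i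
    unfolding u_def
    by (rule filterlim_compose[OF double_pole_tendsto[OF double_pole_phi_finite[OF assms]] filterlim_the])
  note lim = tendsto_sgn_normal[of u, OF this end_coeff_3 end_coeff_independent]
  have "\<forall>\<^sub>F p in atin riemann_sphere (Some z0). gauss_map (atlas m) (omega m) p = sgn (normal_vec (u p))"
  proof -
    have "\<forall>\<^sub>F z in at z0. z \<noteq> z0" by (simp add: eventually_at_filter)
    then have "\<forall>\<^sub>F p in atin riemann_sphere (Some z0). the p \<noteq> z0"
      by (rule eventually_compose_filterlim[OF _ filterlim_the])
    with eventually_regular_atin[of m "Some z0"] show ?thesis
      by eventually_elim (auto simp: gauss_map_eq u_def sgn_normal_scale)
  qed
  with lim show ?thesis
    unfolding vertical_limiting_normal_def by (simp add: tendsto_cong)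
qed

lemma vertical_limiting_normal_infinity:
  assumes "m > 0"
  shows "vertical_limiting_normal riemann_sphere (atlas m) (omega m) None"
proof -
  let ?A = "end_coeff m (- of_real (1 / pole m))"
  define u where "u = (\<lambda>p i. (inv_coord p - 0)\<^sup>2 * (- phi m i (1 / inv_coord p) * (1 / inv_coord p)\<^sup>2))"
  have "((\<lambda>p. u p i) \<longlongrightarrow> ?A i) (atin riemann_sphere None)" for i
    unfolding u_def
    by (rule filterlim_compose[OF double_pole_tendsto[OF double_pole_phi_infinity[OF assms]] filterlim_inv_coord])
  note lim = tendsto_sgn_normal[of u, OF this end_coeff_3 end_coeff_independent]
  have "\<forall>\<^sub>F p in atin riemann_sphere None. gauss_map (atlas m) (omega m) p = sgn (normal_vec (u p))"
    using eventually_regular_atin[of m None]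
  proof eventually_elim
    case (elim p)
    then obtain z where z: "p = Some z" "z \<in> regular m" by auto
    then have "z \<noteq> 0" using regularD by auto
    \<comment> \<open>The squares of the coordinate cancel, and only the sign of the coordinate
      change is left as a common factor.\<close>
    then have u: "u p = (\<lambda>i. - 1 * phi m i z)"
      by (simp add: u_def z(1) fun_eq_iff power_divide)
    have "sgn (normal_vec (\<lambda>i. - 1 * phi m i z)) = sgn (normal_vec (\<lambda>i. phi m i z))"
      by (rule sgn_normal_scale) simp
    with z show ?case unfolding u by (simp only: gauss_map_eq)
  qed
  with lim show ?thesis
    unfolding vertical_limiting_normal_def by (simp add: tendsto_cong)
qed

section \<open>Types and heights of the individual ends\<close>

lemma chart_at_finite_end:
  assumes "z \<notin> regular m"
  shows "chart_at (atlas m) (Some z) = finite_chart"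
  using chart_at_Some[of m z] assms by (auto simp: sphere_atlas_def)

lemma chart_at_None: "chart_at (atlas m) None = infinity_chart (- regular m)"
proof -
  have "chart_at (atlas m) None \<in> atlas m \<and> None \<in> cdom (chart_at (atlas m) None)"
    unfolding chart_at_def
    by (rule someI[of _ "infinity_chart (- regular m)"]) (auto simp: sphere_atlas_def)
  then show ?thesis by (auto simp: sphere_atlas_def)
qed

lemma planar_end_omega:
  assumes "1 \<le> J" "J < m"
  shows "planar_end (atlas m) (omega m) (Some (of_real (pole J)))"
proof -
  have notreg: "of_real (pole J) \<notin> regular m" using assms by (auto simp: regular_def)
  show ?thesis
  proof (rule end_has_type_double_pole[OF chart_at_finite_end[OF notreg]])
    show "cmap finite_chart (Some (of_real (pole J))) = of_real (pole J)" by simp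
    show "double_pole (coeff_fun (omega m $ i) finite_chart) (of_real (pole J)) (end_coeff J (of_real (pole J)) i)" for i
      using double_pole_phi_finite[of J m "of_real (pole J)" i] assms by (simp add: coeff_fun_finite)
    fix a :: real
    show "order_of_pole (\<lambda>w. of_real a * coeff_fun (omega m $ 3) finite_chart w) (of_real (pole J)) = 0"
      by (rule order_of_pole_holomorphic[of "- {0}"])
        (auto simp: coeff_fun_finite phi_def intro!: holomorphic_intros)
  qed (rule end_coeff_3, rule end_coeff_independent, simp_all)
qed

lemma catenoid_end_zero:
  assumes "m > 0"
  shows "catenoid_end (atlas m) (omega m) (Some 0)"
proof (rule end_has_type_double_pole[OF chart_at_finite_end])
  show "cmap finite_chart (Some 0) = 0" by simp
  show "double_pole (coeff_fun (omega m $ i) finite_chart) 0 (end_coeff 0 1 i)" for i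
    using double_pole_phi_finite[of 0 m 0 i] assms by (simp add: coeff_fun_finite pole_def)
  fix a :: real assume "a \<noteq> 0"
  then show "order_of_pole (\<lambda>w. of_real a * coeff_fun (omega m $ 3) finite_chart w) 0 = 1"
    by (intro order_of_poleI[of UNIV _ "\<lambda>_. of_real a"]) (auto simp: coeff_fun_finite phi_def)
qed (rule zero_notin_regular, rule end_coeff_3, rule end_coeff_independent, simp_all)

lemma catenoid_end_infinity:
  assumes "m > 0"
  shows "catenoid_end (atlas m) (omega m) None"
proof (rule end_has_type_double_pole[OF chart_at_None])
  let ?U = "inv_coord ` (- (Some ` (- regular m)))"
  have U: "open ?U" "0 \<in> ?U" using open_infinity_image by (auto simp: image_inv_coord)
  show "cmap (infinity_chart (- regular m)) None = 0" by simp
  show "double_pole (coeff_fun (omega m $ i) (infinity_chart (- regular m))) 0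
      (end_coeff m (- of_real (1 / pole m)) i)" for i
    by (rule double_pole_cong[OF _ U double_pole_phi_infinity[OF assms]])
      (simp add: coeff_fun_infinity)
  fix a :: real assume "a \<noteq> 0"
  \<comment> \<open>In the coordinate \<open>\<zeta> = 1 / z\<close> the form \<open>dz / z\<close>
    becomes \<open>- d\<zeta> / \<zeta>\<close>, hence a simple pole with numerator
    \<open>- a\<close>.\<close>
  then show "order_of_pole (\<lambda>w. of_real a * coeff_fun (omega m $ 3) (infinity_chart (- regular m)) w) 0 = 1"
    using U by (intro order_of_poleI[of ?U _ "\<lambda>_. - of_real a"])
      (auto simp: coeff_fun_infinity phi_def power2_eq_square)
qed (rule end_coeff_3, rule end_coeff_independent, simp_all)

lemma stacked_omega:
  assumes "z0 \<in> regular m" "Q = (\<lambda>j. Some (of_real (pole j))) ` {1..<m}"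
  shows "stacked riemann_sphere (harmonic_map riemann_sphere (atlas m) (ends m) (omega m) (Some z0))
    (Some 0) Q None"
proof -
  define c where "c = ln (norm z0)"
  define f where "f = harmonic_map riemann_sphere (atlas m) (ends m) (omega m) (Some z0)"
  have f: "f p $ 3 = ln (norm (the p)) - c" if "p \<in> Some ` regular m" for p
    using that harmonic_map_eq[OF assms(1)] by (auto simp: f_def surf_def c_def)
  have ev: "\<forall>\<^sub>F p in atin riemann_sphere q. f p $ 3 = ln (norm (the p)) - c" for q
    using eventually_regular_atin[of m q] by eventually_elim (rule f)
  have "filterlim (norm :: complex \<Rightarrow> real) (at_right 0) (at 0)"
    by (auto intro!: filterlim_at_withinI tendsto_norm_zero simp: eventually_at_filter)
  note ln_norm = filterlim_compose[OF ln_at_0 this]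
  have bot: "filterlim (\<lambda>p. f p $ 3) at_bot (atin riemann_sphere (Some 0))"
  proof -
    have "filterlim (\<lambda>p. - ln (norm (the p))) at_top (atin riemann_sphere (Some 0))"
      unfolding filterlim_uminus_at_bot[symmetric]
      by (rule filterlim_compose[OF ln_norm filterlim_the])
    then have "filterlim (\<lambda>p. c + - ln (norm (the p))) at_top (atin riemann_sphere (Some 0))"
      by (rule filterlim_tendsto_add_at_top[OF tendsto_const])
    then have "filterlim (\<lambda>p. ln (norm (the p)) - c) at_bot (atin riemann_sphere (Some 0))"
      unfolding filterlim_uminus_at_bot by simp
    then show ?thesis by (rule iffD2[OF filterlim_cong[OF refl refl ev]])
  qed
  have top: "filterlim (\<lambda>p. f p $ 3) at_top (atin riemann_sphere None)"
  proof -
    \<comment> \<open>Near infinity the height is \<open>- ln (norm \<zeta>)\<close> up to a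
      constant, so the limit of the logarithm at zero serves both catenoid ends.\<close>
    have "filterlim (\<lambda>p. - ln (norm (inv_coord p))) at_top (atin riemann_sphere None)"
      unfolding filterlim_uminus_at_bot[symmetric]
      by (rule filterlim_compose[OF ln_norm filterlim_inv_coord])
    then have lim: "filterlim (\<lambda>p. - c + - ln (norm (inv_coord p))) at_top (atin riemann_sphere None)"
      by (rule filterlim_tendsto_add_at_top[OF tendsto_const])
    have "\<forall>\<^sub>F p in atin riemann_sphere None. - c + - ln (norm (inv_coord p)) = f p $ 3"
      using eventually_regular_atin[of m None]
    proof eventually_elim
      case (elim p)
      then obtain z where z: "p = Some z" "z \<in> regular m" by auto
      then have "z \<noteq> 0" using regularD by auto
      then show ?case using f[OF elim] by (simp add: z(1) norm_divide ln_div)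
    qed
    with lim show ?thesis by (rule filterlim_mono_eventually[OF _ order_refl order_refl])
  qed
  define h where "h = (\<lambda>p. ln (norm (the p :: complex)) - c)"
  have "inj_on h Q"
    using assms(2) by (auto simp: inj_on_def h_def pole_inj)
  moreover have "((\<lambda>p. f p $ 3) \<longlongrightarrow> h p) (atin riemann_sphere p)" if "p \<in> Q" for p
  proof -
    obtain j where p: "p = Some (of_real (pole j))" using \<open>p \<in> Q\<close> unfolding assms(2) by blast
    have "((\<lambda>z. ln (norm z) - c) \<longlongrightarrow> h p) (at (complex_of_real (pole j)))"
      unfolding h_def p by (auto intro!: tendsto_eq_intros)
    from filterlim_compose[OF this filterlim_the]
    have "((\<lambda>q. ln (norm (the q)) - c) \<longlongrightarrow> h p) (atin riemann_sphere p)" unfolding p .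
    then show ?thesis using ev[of p] by (simp add: tendsto_cong)
  qed
  ultimately show ?thesis
    unfolding stacked_def f_def[symmetric] using bot top by blast
qed

theorem theorem3p1:
  fixes n :: nat
  assumes "n \<ge> 1"
  shows "\<exists>(X :: complex option topology) \<A> P \<omega> z0 a b Q.
    harmonic_surface X \<A> P \<omega> \<and> has_genus X 0 \<and>
    z0 \<in> topspace X - P \<and>
    embedded_on \<A> (topspace X - P) (harmonic_map X \<A> P \<omega> z0) \<and>
    card P = 2 * n + 1 \<and>
    P = insert a (insert b Q) \<and> a \<noteq> b \<and> a \<notin> Q \<and> b \<notin> Q \<and> card Q = 2 * n - 1 \<and>
    (\<forall>p\<in>Q. planar_end \<A> \<omega> p) \<and> catenoid_end \<A> \<omega> a \<and> catenoid_end \<A> \<omega> b \<and>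
    stacked X (harmonic_map X \<A> P \<omega> z0) a Q b \<and>
    (\<forall>p\<in>P. vertical_limiting_normal X \<A> \<omega> p)"
proof -
  \<comment> \<open>The indices from \<open>0\<close> to \<open>2 * n\<close> number the
    \<open>2 * n + 1\<close> ends; the \<open>2 * n - 1\<close> interior ones are planar.\<close>
  define m where "m = 2 * n"
  have m: "m > 0" using assms by (simp add: m_def)
  define Q where "Q = (\<lambda>j. Some (complex_of_real (pole j))) ` {1..<m}"
  \<comment> \<open>All finite ends lie on the nonnegative real axis, so \<open>-1\<close> can be
    the base point for every \<open>n\<close>.\<close>
  have reg: "-1 \<in> regular m"
  proof -
    have "- 1 \<notin> (\<lambda>j. complex_of_real (pole j)) ` {1..<m}"
    proof
      assume "- 1 \<in> (\<lambda>j. complex_of_real (pole j)) ` {1..<m}"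
      then obtain j where "- 1 = complex_of_real (pole j)" by blast
      then have "Re (- 1) = pole j" by (metis Re_complex_of_real)
      then show False using pole_pos(1)[of j] by simp
    qed
    then show ?thesis by (simp add: regular_def)
  qed
  have P: "ends m = insert (Some 0) (insert None Q)"
    by (auto simp: ends_def regular_def Q_def)
  have notQ: "Some 0 \<notin> Q" "None \<notin> Q" by (auto simp: Q_def)
  have "inj_on (\<lambda>j. Some (complex_of_real (pole j))) {1..<m}"
    by (auto simp: inj_on_def pole_inj)
  then have cQ: "card Q = 2 * n - 1" by (simp add: Q_def card_image m_def)
  have "finite Q" by (simp add: Q_def)
  then have cP: "card (ends m) = 2 * n + 1"
    using notQ cQ assms by (simp add: P)
  have z0: "Some (-1) \<in> topspace riemann_sphere - ends m"
    using reg compl_ends[of m] by auto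
  have "vertical_limiting_normal riemann_sphere (atlas m) (omega m) p" if "p \<in> Q" for p
    using that vertical_limiting_normal_finite by (force simp: Q_def)
  then have vert: "\<forall>p\<in>ends m. vertical_limiting_normal riemann_sphere (atlas m) (omega m) p"
    unfolding P
    using vertical_limiting_normal_infinity[OF m] vertical_limiting_normal_finite[OF m, of 0] by auto
  have planar: "\<forall>p\<in>Q. planar_end (atlas m) (omega m) p"
    using planar_end_omega[of _ m] by (auto simp: Q_def)
  show ?thesis
    by (intro exI[of _ riemann_sphere] exI[of _ "atlas m"] exI[of _ "ends m"] exI[of _ "omega m"]
        exI[of _ "Some (-1)"] exI[of _ "Some 0"] exI[of _ None] exI[of _ Q] conjI
        harmonic_surface_omega has_genus_riemann_sphere z0 embedded[OF reg] cP P notQ cQ planar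
        catenoid_end_zero[OF m] catenoid_end_infinity[OF m] stacked_omega[OF reg Q_def] vert)
      simp
qed

end
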